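(* Let $k \in \mathbb{N}$ and let $d$ be a positive integer with $d \leq 2k+2$. Let $G$ be a finite graph (parallel edges allowed, loops not allowed) with $$\mathrm{mad}(G) \leq 2k + \frac{2d}{d+k+1}.$$ Then $G$ decomposes into $k+1$ pseudoforests, where one of the pseudoforests has the property that each of its connected components has at most $d$ edges.
   Context: All graphs are finite, may contain multiple (parallel) edges, but have no loops. For a graph $H$, $v(H)=|V(H)|$ and $e(H)=|E(H)|$. The maximum average degree of $G$ is $\mathrm{mad}(G)=\max_{H\subseteq G}\frac{2e(H)}{v(H)}$, the maximum being over all subgraphs $H$ of $G$ with at least one vertex. A pseudoforest is a graph in which each connected component contains at most one cycle (two parallel edges form a cycle of length 2). A decomposition of $G$ is a set of pairwise edge-disjoint subgraphs of $G$ whose edge sets have union $E(G)$; $G$ decomposes into $k+1$ pseudoforests if there is a decomposition of $G$ into $k+1$ subgraphs each of which is a pseudoforest (possibly with no edges). *)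

theory Defs
  imports Complex_Main
begin

record ('v, 'e) pre_multigraph =
  verts :: "'v set"
  edges :: "'e set"
  ends :: "'e \<Rightarrow> 'v set"

text \<open>Parallel edges are distinct edges with the same set of ends; requiring two distinct ends
  rules out loops. The graph without vertices is allowed.\<close>

locale multigraph =
  fixes G :: "('v, 'e) pre_multigraph"
  assumes ends_subset: "e \<in> edges G \<Longrightarrow> ends G e \<subseteq> verts G"
    and card_ends: "e \<in> edges G \<Longrightarrow> card (ends G e) = 2"

locale finite_multigraph = multigraph +
  assumes finite_verts: "finite (verts G)"
    and finite_edges: "finite (edges G)"

text \<open>A subgraph carries the whole map \<open>ends G\<close>, also on elements that are not edges.
  Therefore subgraphs of \<open>G\<close> with the same vertices and the same edges are equal as records.\<close>

definition subgraph :: "('v, 'e) pre_multigraph \<Rightarrow> ('v, 'e) pre_multigraph \<Rightarrow> bool" where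
  "subgraph H G \<longleftrightarrow>
     multigraph H \<and> verts H \<subseteq> verts G \<and> edges H \<subseteq> edges G \<and> ends H = ends G"

text \<open>For \<open>G\<close> without vertices the maximum ranges over the empty set, and \<open>mad G\<close> is unspecified.\<close>

definition mad :: "('v, 'e) pre_multigraph \<Rightarrow> real" where
  "mad G = Max {2 * real (card (edges H)) / real (card (verts H)) | H.
                  subgraph H G \<and> verts H \<noteq> {}}"

lemma (in finite_multigraph) finite_subgraphs: "finite {H. subgraph H G}"
proof (rule finite_subset)
  show "{H. subgraph H G} \<subseteq>
    (\<lambda>(V, E). \<lparr>verts = V, edges = E, ends = ends G\<rparr>) ` (Pow (verts G) \<times> Pow (edges G))"
  proof
    fix H assume "H \<in> {H. subgraph H G}"
    then show "H \<in> (\<lambda>(V, E). \<lparr>verts = V, edges = E, ends = ends G\<rparr>) `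
        (Pow (verts G) \<times> Pow (edges G))"
      by (intro image_eqI[of _ _ "(verts H, edges H)"]) (auto simp: subgraph_def)
  qed
qed (simp add: finite_verts finite_edges)

lemma (in finite_multigraph) subgraph_average_le_mad:
  assumes "subgraph H G" and "verts H \<noteq> {}"
  shows "2 * real (card (edges H)) / real (card (verts H)) \<le> mad G"
  unfolding mad_def by (rule Max_ge) (use assms finite_subgraphs in auto)

definition connected_graph :: "('v, 'e) pre_multigraph \<Rightarrow> bool" where
  "connected_graph G \<longleftrightarrow> verts G \<noteq> {} \<and>
     (\<forall>u\<in>verts G. \<forall>v\<in>verts G. (u, v) \<in> {(x, y). \<exists>e\<in>edges G. ends G e = {x, y}}\<^sup>*)"

definition connected_component :: "('v, 'e) pre_multigraph \<Rightarrow> ('v, 'e) pre_multigraph \<Rightarrow> bool" where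
  "connected_component C G \<longleftrightarrow> subgraph C G \<and> connected_graph C \<and>
     (\<forall>D. subgraph D G \<and> connected_graph D \<and> subgraph C D \<longrightarrow> D = C)"

text \<open>The edge \<open>es ! i\<close> joins \<open>vs ! i\<close> to its cyclic successor in \<open>vs\<close>. In length 2 the two
  edges are parallel.\<close>

definition cycle_graph :: "('v, 'e) pre_multigraph \<Rightarrow> bool" where
  "cycle_graph C \<longleftrightarrow> (\<exists>vs es. length vs \<ge> 2 \<and> length es = length vs \<and>
     distinct vs \<and> distinct es \<and> verts C = set vs \<and> edges C = set es \<and>
     (\<forall>i<length vs. ends C (es ! i) = {vs ! i, vs ! (Suc i mod length vs)}))"

definition pseudoforest :: "('v, 'e) pre_multigraph \<Rightarrow> bool" where
  "pseudoforest G \<longleftrightarrow> multigraph G \<and>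
     (\<forall>K. connected_component K G \<longrightarrow> (\<exists>\<^sub>\<le>\<^sub>1 C. subgraph C K \<and> cycle_graph C))"

text \<open>A decomposition is an indexed family rather than a set, so that several of its members
  may be the same edgeless graph.\<close>

definition decomposition ::
  "('v, 'e) pre_multigraph \<Rightarrow> 'i set \<Rightarrow> ('i \<Rightarrow> ('v, 'e) pre_multigraph) \<Rightarrow> bool" where
  "decomposition G I H \<longleftrightarrow> (\<forall>i\<in>I. subgraph (H i) G) \<and>
     (\<forall>i\<in>I. \<forall>j\<in>I. i \<noteq> j \<longrightarrow> edges (H i) \<inter> edges (H j) = {}) \<and>
     (\<Union>i\<in>I. edges (H i)) = edges G"

end

theory Submission
  imports Defs
begin

text \<open>Insert the edges one by one and keep a red forest whose components have at most \<open>d\<close> edges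
  together with an orientation of the remaining, blue edges with outdegrees at most \<open>k\<close>; the blue
  edges then split into \<open>k\<close> pseudoforests. A new edge overloads at most one vertex \<open>u\<close>. Explore
  from the red component of \<open>u\<close> along blue edges (forwards) and red edges (in both directions), and
  choose colouring and exploration sequence of red components with lexicographically least sizes.
  Then no vertex reached has outdegree below \<open>k\<close>, a component and its parent have at least \<open>d\<close>
  edges together, and the children with fewer than \<open>d / (k + 1)\<close> edges of a component all hang at
  the same vertex, so that there are at most \<open>k\<close> of them (one more at \<open>u\<close>). Grouping small
  components with their parents, the subgraph reached exceeds the average degree allowed.\<close>

section \<open>Preliminaries\<close>

lemma lexn_nthI:
  assumes "length ys = n" "length xs = n" "i < n" "\<And>j. j < i \<Longrightarrow> ys ! j = xs ! j" "(ys ! i, xs ! i) \<in> r"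
  shows "(ys, xs) \<in> lexn r n"
proof -
  have "take i ys = take i xs" using assms(1-4) by (auto intro: nth_equalityI)
  then have "xs = take i ys @ xs ! i # drop (Suc i) xs" "ys = take i ys @ ys ! i # drop (Suc i) ys"
    using assms(1-3) id_take_nth_drop[of i xs] id_take_nth_drop[of i ys] by auto
  then show ?thesis using assms(1,2,5) unfolding lexn_conv by blast
qed

text \<open>Here \<open>c i\<close> stands for the number of edges of the \<open>i\<close>-th red
  component and \<open>p i\<close> for its parent. Components of negative charge
  \<open>(k + 1) * c i - d\<close> are grouped with their parents, which by \<open>pair\<close> have
  positive charge themselves. A parent with \<open>s > 0\<close> such children has by
  \<open>pair\<close> a group charge of at least \<open>(k - s) * d\<close>, which drops below zero
  only at the root with \<open>s = k + 1\<close>.\<close>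

lemma charge_bound:
  fixes c :: "nat \<Rightarrow> int" and p :: "nat \<Rightarrow> nat"
  assumes "0 < m" and k: "1 \<le> k"
    and par: "\<And>i. i \<in> {1..<m} \<Longrightarrow> p i < m"
    and pair: "\<And>i. i \<in> {1..<m} \<Longrightarrow> int d \<le> c (p i) + c i"
    and few: "\<And>j. j < m \<Longrightarrow>
      card {i \<in> {1..<m}. (int k + 1) * c i < int d \<and> p i = j} \<le> k + (if j = 0 then 1 else 0)"
    and nonneg: "\<And>i. 0 \<le> c i"
  shows "- int d \<le> (\<Sum>i<m. (int k + 1) * c i - int d)"
proof -
  define w where "w i = (int k + 1) * c i - int d" for i
  \<comment> \<open>Index 0 has no parent and stays out of \<open>S\<close> even if its charge is
    negative; that charge is at least \<open>- d\<close>.\<close>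
  define S where "S = {i \<in> {1..<m}. w i < 0}"
  define T where "T = {..<m} - S"
  have fin: "finite S" "finite T" by (auto simp: S_def T_def)
  have pT: "p i \<in> T" if i: "i \<in> S" for i
  proof -
    have "2 * int d \<le> (int k + 1) * int d" using k by (intro mult_right_mono) auto
    also have "\<dots> \<le> (int k + 1) * (c (p i) + c i)" using pair[of i] i by (intro mult_left_mono) (auto simp: S_def)
    finally have "0 \<le> w (p i) + w i" by (simp add: w_def algebra_simps)
    then show ?thesis using par[of i] i by (auto simp: S_def T_def)
  qed
  have group: "(if j = 0 then - int d else 0) \<le> w j + (\<Sum>i\<in>{i \<in> S. p i = j}. w i)" if j: "j \<in> T" for j
  proof (cases "{i \<in> S. p i = j} = {}")
    case True
    show ?thesis unfolding True using j nonneg[of j] by (auto simp: S_def T_def w_def)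
  next
    case False
    let ?S = "{i \<in> S. p i = j}"
    from False obtain i0 where i0: "i0 \<in> ?S" by blast
    have "c i0 \<le> (\<Sum>i\<in>?S. c i)" by (rule member_le_sum[OF i0]) (use nonneg fin in auto)
    moreover have "int d \<le> c j + c i0" using pair[of i0] i0 by (auto simp: S_def)
    ultimately have "(int k + 1) * int d \<le> (int k + 1) * (c j + (\<Sum>i\<in>?S. c i))"
      by (intro mult_left_mono) auto
    moreover have "card ?S \<le> k + (if j = 0 then 1 else 0)"
      using few[of j] j by (simp add: S_def T_def w_def conj_assoc)
    then have "int (card ?S) * int d \<le> (int k + (if j = 0 then 1 else 0)) * int d"
      by (intro mult_right_mono) auto
    moreover have "(\<Sum>i\<in>?S. w i) = (int k + 1) * (\<Sum>i\<in>?S. c i) - int (card ?S) * int d"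
      by (simp add: w_def sum_subtractf sum_distrib_left)
    ultimately show ?thesis by (auto simp: w_def algebra_simps split: if_splits)
  qed
  have "- int d \<le> (\<Sum>j\<in>T. if j = 0 then - int d else 0)" by (simp add: fin sum.delta)
  also have "\<dots> \<le> (\<Sum>j\<in>T. w j + (\<Sum>i\<in>{i \<in> S. p i = j}. w i))" by (rule sum_mono) (rule group)
  also have "\<dots> = sum w T + sum w S"
    using sum.group[OF fin, of p w] pT by (simp add: sum.distrib image_subset_iff)
  also have "\<dots> = sum w {..<m}"
    unfolding T_def by (rule sum.subset_diff[symmetric]) (auto simp: S_def)
  finally show ?thesis by (simp add: w_def)
qed

section \<open>Reachability and forests\<close>

locale edge_graph =
  fixes ends :: "'e \<Rightarrow> 'v set" and E :: "'e set"
  assumes finite_E: "finite E"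
    and card_ends: "e \<in> E \<Longrightarrow> card (ends e) = 2"
begin

definition reach :: "'e set \<Rightarrow> ('v \<times> 'v) set" where
  "reach F = {(x, y). \<exists>e\<in>F. ends e = {x, y}}\<^sup>*"

definition comp :: "'e set \<Rightarrow> 'v \<Rightarrow> 'v set" where
  "comp F x = {y. (x, y) \<in> reach F}"

text \<open>Acyclicity in the form that every edge is a bridge, which suits adding and deleting
  single edges and treats two parallel edges as a cycle.\<close>

definition forest :: "'e set \<Rightarrow> bool" where
  "forest F \<longleftrightarrow> (\<forall>e\<in>F. \<forall>x y. ends e = {x, y} \<longrightarrow> (x, y) \<notin> reach (F - {e}))"

definition induced :: "'e set \<Rightarrow> 'v set \<Rightarrow> 'e set" where
  "induced F X = {e \<in> F. ends e \<subseteq> X}"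

lemma endsE:
  assumes "e \<in> E" "x \<in> ends e"
  obtains y where "ends e = {x, y}" "x \<noteq> y"
  using card_ends[OF assms(1)] assms(2) by (force simp: card_2_iff insert_commute)

lemma reach_refl [simp]: "(x, x) \<in> reach F"
  by (simp add: reach_def)

lemma reach_sym: "(x, y) \<in> reach F \<Longrightarrow> (y, x) \<in> reach F"
  unfolding reach_def by (erule symD[OF sym_rtrancl, rotated]) (auto simp: sym_def insert_commute)

lemma reach_trans: "(x, y) \<in> reach F \<Longrightarrow> (y, z) \<in> reach F \<Longrightarrow> (x, z) \<in> reach F"
  unfolding reach_def by (rule rtrancl_trans)

lemma reach_mono: "F \<subseteq> F' \<Longrightarrow> (x, y) \<in> reach F \<Longrightarrow> (x, y) \<in> reach F'"
  unfolding reach_def by (erule rtrancl_mono[THEN subsetD, rotated]) auto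

lemma reach_edge: "e \<in> F \<Longrightarrow> ends e = {x, y} \<Longrightarrow> (x, y) \<in> reach F"
  unfolding reach_def by auto

text \<open>A walk can be shortened so that it uses \<open>a\<close> at most once, in one of the two
  directions.\<close>

lemma reach_insert:
  assumes "ends a = {x, y}"
  shows "(p, q) \<in> reach (insert a F) \<longleftrightarrow> (p, q) \<in> reach F \<or>
    (p, x) \<in> reach F \<and> (y, q) \<in> reach F \<or> (p, y) \<in> reach F \<and> (x, q) \<in> reach F"
    (is "?L \<longleftrightarrow> ?R q")
proof
  assume ?L
  then show "?R q"
    unfolding reach_def[of "insert a F"]
  proof (induction rule: rtrancl_induct)
    case base
    then show ?case by simp
  next
    case (step q r)
    from step(2) obtain e where e: "e \<in> insert a F" "ends e = {q, r}" by auto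
    show ?case
    proof (cases "e = a")
      case True
      then have "q = x \<and> r = y \<or> q = y \<and> r = x"
        using e assms by (auto simp: doubleton_eq_iff)
      then show ?thesis using step(3) by (metis reach_refl reach_trans reach_sym)
    next
      case False
      then have "(q, r) \<in> reach F" using e by (auto intro: reach_edge)
      then show ?thesis using step(3) by (metis reach_trans)
    qed
  qed
next
  have "(x, y) \<in> reach (insert a F)" using assms by (auto intro: reach_edge)
  moreover assume "?R q"
  ultimately show ?L by (meson reach_mono subset_insertI reach_trans reach_sym)
qed

lemma comp_self [simp]: "x \<in> comp F x"
  by (simp add: comp_def)

lemma comp_eq: "y \<in> comp F x \<Longrightarrow> comp F y = comp F x"
  unfolding comp_def using reach_trans reach_sym by blast

lemma comp_sym: "y \<in> comp F x \<longleftrightarrow> x \<in> comp F y"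
  unfolding comp_def using reach_sym by blast

lemma comp_mono: "F \<subseteq> F' \<Longrightarrow> comp F x \<subseteq> comp F' x"
  unfolding comp_def using reach_mono by blast

lemma comp_disjoint: "y \<notin> comp F x \<Longrightarrow> comp F x \<inter> comp F y = {}"
  using comp_eq comp_self by blast

lemma comp_ends:
  assumes "e \<in> F" "ends e = {p, q}"
  shows "p \<in> comp F x \<longleftrightarrow> q \<in> comp F x"
  using reach_edge[OF assms] unfolding comp_def by (metis mem_Collect_eq reach_trans reach_sym)

lemma comp_subset: "comp F x \<subseteq> insert x (\<Union>e\<in>F. ends e)"
proof
  fix y assume "y \<in> comp F x"
  then have "(x, y) \<in> {(x, y). \<exists>e\<in>F. ends e = {x, y}}\<^sup>*" by (simp add: comp_def reach_def)
  then show "y \<in> insert x (\<Union>e\<in>F. ends e)"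
    by (cases rule: rtranclE) auto
qed

lemma finite_ends: "e \<in> E \<Longrightarrow> finite (ends e)"
  using card_ends by (metis card.infinite zero_neq_numeral)

lemma finite_comp:
  assumes "F \<subseteq> E"
  shows "finite (comp F x)"
proof -
  have "finite F" using assms finite_E by (rule finite_subset)
  then have "finite (insert x (\<Union>e\<in>F. ends e))"
    by (simp add: finite_ends[OF subsetD[OF assms]])
  then show ?thesis using comp_subset by (rule finite_subset[rotated])
qed

lemma comp_insert:
  assumes "ends a = {x, y}"
  shows "comp (insert a F) x = comp F x \<union> comp F y"
  by (auto simp: comp_def reach_insert[OF assms])

lemma comp_insert_other:
  assumes "ends a = {x, y}" "x \<notin> comp F p" "y \<notin> comp F p"
  shows "comp (insert a F) p = comp F p"
  using assms unfolding comp_def by (auto simp: reach_insert)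

lemma comp_delete:
  assumes "e \<in> F" "ends e = {p, q}" "(p, q) \<in> reach (F - {e})"
  shows "comp (F - {e}) x = comp F x"
proof -
  have "(x, y) \<in> reach F \<longleftrightarrow> (x, y) \<in> reach (F - {e})" for y
    using reach_insert[OF assms(2), of x y "F - {e}"] assms(3) unfolding insert_Diff[OF assms(1)]
    by (meson reach_sym reach_trans)
  then show ?thesis by (simp add: comp_def)
qed

lemma comp_delete_other:
  assumes "f \<in> F" "ends f = {x, z}" "x \<notin> comp F p"
  shows "comp (F - {f}) p = comp F p"
proof -
  have "x \<notin> comp (F - {f}) p" "z \<notin> comp (F - {f}) p"
    using assms comp_mono[of "F - {f}" F p] comp_ends[OF assms(1,2)] by auto
  from comp_insert_other[OF assms(2) this] show ?thesis
    using assms(1) by (simp add: insert_absorb)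
qed

section \<open>Forests under insertion and deletion of edges\<close>

lemma forest_subset: "forest F \<Longrightarrow> F' \<subseteq> F \<Longrightarrow> forest F'"
  unfolding forest_def by (meson Diff_mono order_refl reach_mono subsetD)

text \<open>A cycle through an old edge \<open>e\<close> would have to use \<open>a\<close>; its
  remainder together with \<open>e\<close> would connect \<open>x\<close> to \<open>y\<close> within
  \<open>F\<close>.\<close>

lemma forest_insert:
  assumes "forest F" "ends a = {x, y}" "y \<notin> comp F x"
  shows "forest (insert a F)"
  unfolding forest_def
proof (intro ballI allI impI)
  fix e p q assume e: "e \<in> insert a F" "ends e = {p, q}"
  have xy: "(x, y) \<notin> reach F" using assms(3) by (simp add: comp_def)
  show "(p, q) \<notin> reach (insert a F - {e})"
  proof (cases "e = a")
    case True
    then have "p = x \<and> q = y \<or> p = y \<and> q = x"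
      using e assms(2) by (auto simp: doubleton_eq_iff)
    moreover have "insert a F - {e} \<subseteq> F" using True by auto
    ultimately show ?thesis using xy by (meson reach_mono reach_sym)
  next
    case False
    then have eF: "e \<in> F" using e by simp
    have pq: "(p, q) \<in> reach F" using eF e by (auto intro: reach_edge)
    have no: "(p, q) \<notin> reach (F - {e})" using assms(1) eF e unfolding forest_def by blast
    have eq: "insert a F - {e} = insert a (F - {e})" using False by auto
    have "(v, w) \<in> reach F" if "(v, w) \<in> reach (F - {e})" for v w
      using that by (meson reach_mono Diff_subset)
    then show ?thesis
      unfolding eq reach_insert[OF assms(2)] using no pq xy by (meson reach_sym reach_trans)
  qed
qed

lemma forest_delete_comp:
  assumes "forest F" "f \<in> F" "ends f = {x, z}"
  shows "comp F x = comp (F - {f}) x \<union> comp (F - {f}) z" "z \<notin> comp (F - {f}) x"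
  using comp_insert[OF assms(3), of "F - {f}"] assms
  by (auto simp: insert_absorb forest_def comp_def)

lemma forest_delete_card:
  assumes "forest F" "F \<subseteq> E" "f \<in> F" "ends f = {x, z}"
  shows "card (comp F x) = card (comp (F - {f}) x) + card (comp (F - {f}) z)"
proof -
  have "F - {f} \<subseteq> E" using assms(2) by auto
  then show ?thesis
    using forest_delete_comp[OF assms(1,3,4)] comp_disjoint[of z "F - {f}" x]
    by (simp add: card_Un_disjoint finite_comp)
qed

text \<open>The edge is found from the far end: a walk from \<open>w\<close> is followed until it
  first meets \<open>x\<close>, and \<open>f\<close> is the edge used there. Before that moment only
  edges of \<open>F'\<close> are used.\<close>

lemma edge_towards:
  assumes "forest F" "F \<subseteq> E" "w \<in> comp F x" "x \<noteq> w"
  obtains f z where "f \<in> F" "ends f = {x, z}" "w \<in> comp (F - {f}) z" "w \<notin> comp (F - {f}) x"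
proof -
  define F' where "F' = {e \<in> F. x \<notin> ends e}"
  have x: "(w, x) \<notin> reach F'"
    using comp_subset[of F' w] assms(4) by (auto simp: F'_def comp_def)
  have "(w, y) \<in> {(x, y). \<exists>e\<in>F. ends e = {x, y}}\<^sup>* \<Longrightarrow>
      (w, y) \<in> reach F' \<or> (\<exists>f\<in>F. \<exists>z. ends f = {x, z} \<and> (w, z) \<in> reach F')" for y
  proof (induction rule: rtrancl_induct)
    case base
    then show ?case by simp
  next
    case (step y y')
    from step(2) obtain e where e: "e \<in> F" "ends e = {y, y'}" by auto
    show ?case
    proof (cases "(w, y) \<in> reach F' \<and> x \<in> ends e")
      case True
      then have "y' = x" using e x by auto
      then show ?thesis using True e by (auto simp: insert_commute)
    next
      case False
      then show ?thesis using step(3) e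
        by (metis (mono_tags, lifting) F'_def mem_Collect_eq reach_edge reach_trans)
    qed
  qed
  moreover have "(w, x) \<in> {(x, y). \<exists>e\<in>F. ends e = {x, y}}\<^sup>*"
    using reach_sym assms(3) unfolding comp_def reach_def[symmetric] by blast
  ultimately obtain f z where f: "f \<in> F" "ends f = {x, z}" "(w, z) \<in> reach F'"
    using x by blast
  have "F' \<subseteq> F - {f}" using f by (auto simp: F'_def)
  then have wz: "w \<in> comp (F - {f}) z" using f reach_mono reach_sym by (auto simp: comp_def)
  have "w \<notin> comp (F - {f}) x"
    using forest_delete_comp(2)[OF assms(1) f(1,2)] comp_eq[OF wz] comp_sym comp_eq by blast
  with f wz show ?thesis using that by blast
qed

lemma comp_avoid:
  assumes "f \<in> F" "x \<in> ends f" "x \<notin> comp F p"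
  shows "comp F p = comp (F - {f}) p"
proof
  show "comp F p \<subseteq> comp (F - {f}) p"
  proof
    fix q assume "q \<in> comp F p"
    then have "(p, q) \<in> {(x, y). \<exists>e\<in>F. ends e = {x, y}}\<^sup>*" by (simp add: comp_def reach_def)
    then show "q \<in> comp (F - {f}) p"
    proof (induction rule: rtrancl_induct)
      case base
      then show ?case by simp
    next
      case (step q r)
      from step(2) obtain e where e: "e \<in> F" "ends e = {q, r}" by auto
      have q: "q \<in> comp F p" using step(3) comp_mono[of "F - {f}" F p] by auto
      then have "r \<in> comp F p" using comp_ends[OF e] by simp
      with q have "e \<noteq> f" using assms e by auto
      then show ?case using step(3) comp_ends[of e "F - {f}" q r] e by auto
    qed
  qed
qed (simp add: comp_mono)

text \<open>Induction on the edges: the new edge either lies apart from the component of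
  \<open>x\<close> or joins two trees, and then it makes up for the surplus vertex of one of
  them.\<close>

lemma forest_card_comp:
  assumes "F \<subseteq> E" "forest F"
  shows "card (comp F x) = Suc (card (induced F (comp F x)))"
proof -
  have "finite F" using assms(1) finite_E finite_subset by blast
  then show ?thesis using assms
  proof (induction F arbitrary: x rule: finite_induct)
    case empty
    have "comp {} x = {x}" using comp_subset[of "{}" x] comp_self[of x "{}"] by auto
    then show ?case by (simp add: induced_def)
  next
    case (insert a F)
    then obtain p q where a: "ends a = {p, q}" "a \<in> E" by (meson card_ends card_2_iff insertI1 subsetD)
    have forest: "forest F" "q \<notin> comp F p" using forest_delete_comp(2)[OF insert.prems(2) _ a(1)]
      insert.hyps forest_subset[OF insert.prems(2)] by auto
    have F: "F \<subseteq> E" using insert.prems by simp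
    show ?case
    proof (cases "p \<in> comp F x \<or> q \<in> comp F x")
      case True
      then have "x \<in> comp (insert a F) p"
        using comp_insert[OF a(1)] comp_sym by blast
      then have c: "comp (insert a F) x = comp F p \<union> comp F q"
        using comp_eq comp_insert[OF a(1)] by metis
      have dis: "comp F p \<inter> comp F q = {}" using comp_disjoint[OF forest(2)] .
      have "induced (insert a F) (comp F p \<union> comp F q) =
          insert a (induced F (comp F p) \<union> induced F (comp F q))" (is "?l = ?r")
      proof
        show "?l \<subseteq> ?r"
        proof
          fix e assume e: "e \<in> ?l"
          show "e \<in> ?r"
          proof (cases "e = a")
            case False
            then have "e \<in> F" using e by (auto simp: induced_def)
            moreover obtain r s where "ends e = {r, s}"
              using F card_ends[of e] \<open>e \<in> F\<close> by (auto simp: card_2_iff)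
            ultimately show ?thesis
              using e comp_ends[of e F r s p] comp_ends[of e F r s q] by (auto simp: induced_def)
          qed simp
        qed
      qed (use a in \<open>auto simp: induced_def\<close>)
      moreover have "induced F (comp F p) \<inter> induced F (comp F q) = {}"
      proof (rule equals0I)
        fix e assume "e \<in> induced F (comp F p) \<inter> induced F (comp F q)"
        then have "e \<in> E" "ends e \<subseteq> comp F p \<inter> comp F q" using F by (auto simp: induced_def)
        then show False using dis card_ends[of e] by simp
      qed
      moreover have "finite (induced F X)" "a \<notin> induced F X" for X
        using insert.hyps by (auto simp: induced_def)
      ultimately show ?thesis
        using dis c insert.IH[OF F forest(1), of p] insert.IH[OF F forest(1), of q]
        by (simp add: card_Un_disjoint finite_comp F)
    next
      case False
      then have c: "comp (insert a F) x = comp F x" using comp_insert_other[OF a(1)] by blast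
      have "induced (insert a F) (comp F x) = induced F (comp F x)"
        using False a by (auto simp: induced_def)
      then show ?thesis using c insert.IH[OF F forest(1)] by simp
    qed
  qed
qed

text \<open>Deleting an edge on a cycle keeps the vertex set of every component and adds no edges,
  which reduces the claim to forests.\<close>

lemma card_comp_le:
  assumes "F \<subseteq> E"
  shows "card (comp F x) \<le> Suc (card (induced F (comp F x)))"
proof -
  have "finite F" using assms finite_E finite_subset by blast
  then show ?thesis using assms
  proof (induction F rule: finite_psubset_induct)
    case (psubset F)
    show ?case
    proof (cases "forest F")
      case True
      then show ?thesis using forest_card_comp psubset.prems by simp
    next
      case False
      then obtain e p q where e: "e \<in> F" "ends e = {p, q}" "(p, q) \<in> reach (F - {e})"
        unfolding forest_def by blast
      then have c: "comp F x = comp (F - {e}) x" by (simp add: comp_delete)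
      have "induced (F - {e}) (comp F x) \<subseteq> induced F (comp F x)" by (auto simp: induced_def)
      then have "card (induced (F - {e}) (comp F x)) \<le> card (induced F (comp F x))"
        using psubset.hyps by (intro card_mono) (auto simp: induced_def)
      moreover have "F - {e} \<subset> F" "F - {e} \<subseteq> E" using e(1) psubset.prems by auto
      ultimately show ?thesis using psubset.IH[of "F - {e}"] unfolding c by linarith
    qed
  qed
qed

end

section \<open>Recolouring\<close>

text \<open>The edges in \<open>F\<close> are red, those in \<open>A - F\<close> are blue and a blue edge \<open>e\<close> leaves the vertex
  \<open>t e\<close>. Only \<open>u\<close> may have one blue edge too many. The proof removes this defect by moving along a
  sequence of red components that starts with the component of \<open>u\<close> and enters each further
  component through a blue edge.\<close>

locale recolouring = edge_graph ends E
  for ends :: "'e \<Rightarrow> 'v set" and E :: "'e set" +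
  fixes A :: "'e set" and k d :: nat and u :: 'v
  assumes A_subset: "A \<subseteq> E"
begin

section \<open>Colourings, sequences of components and improvements\<close>

definition out :: "'e set \<Rightarrow> ('e \<Rightarrow> 'v) \<Rightarrow> 'v \<Rightarrow> 'e set" where
  "out F t v = {e \<in> A - F. t e = v}"

definition cap :: "'v \<Rightarrow> nat" where
  "cap v = k + (if v = u then 1 else 0)"

text \<open>\<open>Suc d\<close> counts vertices: a red tree with that many vertices has
  \<open>d\<close> edges.\<close>

definition colouring :: "'e set \<Rightarrow> ('e \<Rightarrow> 'v) \<Rightarrow> bool" where
  "colouring F t \<longleftrightarrow> F \<subseteq> A \<and> forest F \<and> (\<forall>e\<in>A. t e \<in> ends e) \<and>
     (\<forall>x. card (comp F x) \<le> Suc d) \<and> (\<forall>v. card (out F t v) \<le> cap v)"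

definition solved :: bool where
  "solved \<longleftrightarrow> (\<exists>F t. colouring F t \<and> card (out F t u) \<le> k)"

text \<open>The \<open>l\<close>-th component may be left at any of its vertices, but
  \<open>xs ! i\<close> is the very vertex where \<open>e\<close> arrives. So \<open>xs\<close>
  lists the components by their entrances.\<close>

definition entry :: "'e set \<Rightarrow> ('e \<Rightarrow> 'v) \<Rightarrow> 'v list \<Rightarrow> nat \<Rightarrow> nat \<Rightarrow> 'e \<Rightarrow> bool" where
  "entry F t xs l i e \<longleftrightarrow>
     l < i \<and> e \<in> A - F \<and> ends e = {t e, xs ! i} \<and> t e \<in> comp F (xs ! l)"

definition legal :: "'e set \<Rightarrow> ('e \<Rightarrow> 'v) \<Rightarrow> 'v list \<Rightarrow> bool" where
  "legal F t xs \<longleftrightarrow> xs \<noteq> [] \<and> xs ! 0 = u \<and>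
     (\<forall>i<length xs. \<forall>j<i. xs ! i \<notin> comp F (xs ! j)) \<and>
     (\<forall>i<length xs. 0 < i \<longrightarrow> (\<exists>l e. entry F t xs l i e))"

text \<open>Lexicographic descent of the component sizes with first change at \<open>j\<close>.
  Positions after \<open>j\<close> are unrestricted, so the new sequence may stop at
  \<open>j\<close>.\<close>

definition improves :: "'e set \<Rightarrow> 'v list \<Rightarrow> nat \<Rightarrow> bool" where
  "improves F xs j \<longleftrightarrow> (\<exists>F' t' xs'. colouring F' t' \<and> legal F' t' xs' \<and> j < length xs' \<and>
     (\<forall>l<j. card (comp F' (xs' ! l)) = card (comp F (xs ! l))) \<and>
     card (comp F' (xs' ! j)) < card (comp F (xs ! j)))"

lemma improves_cong:
  assumes "\<And>l. l \<le> j \<Longrightarrow> card (comp F (xs ! l)) = card (comp F' (ys ! l))"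
  shows "improves F xs j \<longleftrightarrow> improves F' ys j"
  unfolding improves_def using assms by (simp cong: conj_cong)

lemma improvesI:
  assumes "colouring F' t'" "legal F' t' (take (Suc j) xs)" "j < length xs"
    "\<And>l. l < j \<Longrightarrow> comp F' (xs ! l) = comp F (xs ! l)"
    "card (comp F' (xs ! j)) < card (comp F (xs ! j))"
  shows "improves F xs j"
  unfolding improves_def
  by (intro exI[of _ F'] exI[of _ t'] exI[of _ "take (Suc j) xs"]) (use assms in auto)

lemma colouring_subset: "colouring F t \<Longrightarrow> F \<subseteq> E"
  using A_subset by (auto simp: colouring_def)

lemma finite_out [simp]: "finite (out F t v)"
  unfolding out_def by (rule finite_subset[OF _ finite_subset[OF A_subset finite_E]]) auto

lemma legal_distinct:
  assumes "legal F t xs" "i < length xs" "j < length xs" "i \<noteq> j"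
  shows "xs ! i \<notin> comp F (xs ! j)"
  using assms comp_sym unfolding legal_def by (metis linorder_neqE_nat)

lemma legal_disjoint:
  assumes "legal F t xs" "i < length xs" "j < length xs" "i \<noteq> j" "v \<in> comp F (xs ! i)"
  shows "v \<notin> comp F (xs ! j)"
  using legal_distinct[OF assms(1-4)] assms(5) comp_eq comp_self by metis

text \<open>This ensures that an edge being recoloured or reversed is not the entering edge of an
  earlier component, and that different children have different entering edges.\<close>

lemma entry_head_unique:
  assumes "legal F t xs" "entry F t xs l i e" "entry F t xs l' i' e" "i < length xs" "i' < length xs"
  shows "i = i'"
proof -
  have "xs ! i = xs ! i'" using assms(2,3) by (auto simp: entry_def doubleton_eq_iff)
  then show ?thesis using legal_distinct[OF assms(1,4,5)] by force
qed

text \<open>The last component of the prefix may change, because the conditions on an entrance refer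
  only to components strictly before it.\<close>

lemma legal_transfer:
  assumes "legal F t xs" "0 < m" "m \<le> length xs"
    and comps: "\<And>i. Suc i < m \<Longrightarrow> comp F' (xs ! i) = comp F (xs ! i)"
    and entries: "\<And>l i e. i < m \<Longrightarrow> entry F t xs l i e \<Longrightarrow> e \<notin> F' \<and> t' e = t e"
  shows "legal F' t' (take m xs)"
  unfolding legal_def
proof (intro conjI allI impI)
  show "take m xs \<noteq> []" "take m xs ! 0 = u" using assms(1-3) by (auto simp: legal_def)
next
  fix i j assume ij: "i < length (take m xs)" "j < i"
  then have "xs ! i \<notin> comp F (xs ! j)" using assms(1,3) by (auto simp: legal_def)
  then show "take m xs ! i \<notin> comp F' (take m xs ! j)" using comps[of j] ij by simp
next
  fix i assume i: "i < length (take m xs)" "0 < i"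
  then obtain l e where e: "entry F t xs l i e" using assms(1) by (auto simp: legal_def)
  moreover have "entry F' t' (take m xs) l i e"
    using e i entries[of i l e] comps[of l] by (auto simp: entry_def)
  ultimately show "\<exists>l e. entry F' t' (take m xs) l i e" by blast
qed

section \<open>Recolouring moves\<close>

text \<open>A free place for a blue edge at a vertex \<open>v\<close> of the sequence is filled with the red edge at
  \<open>v\<close> pointing to the entrance of its component. If \<open>v\<close> is itself the entrance, reversing the
  entering edge moves the free place to an earlier component.\<close>

lemma free_place:
  assumes "colouring F t" "legal F t xs" "j < length xs" "v \<in> comp F (xs ! j)"
    "card (out F t v) < cap v"
  shows "solved \<or> (\<exists>i\<le>j. (v = xs ! j \<longrightarrow> i < j) \<and> improves F xs i)"
  using assms
proof (induction j arbitrary: t v xs rule: less_induct)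
  case (less j)
  note col = less.prems(1) and leg = less.prems(2) and j = less.prems(3)
  have FE: "F \<subseteq> E" and fo: "forest F" and FA: "F \<subseteq> A"
    using col colouring_subset by (auto simp: colouring_def)
  show ?case
  proof (cases "v = xs ! j")
    case False
    have "xs ! j \<in> comp F v" using less.prems(4) comp_sym by blast
    then obtain f z where f: "f \<in> F" "ends f = {v, z}" "xs ! j \<notin> comp (F - {f}) v"
      using edge_towards[OF fo FE _ False] by metis
    \<comment> \<open>Turned blue and leaving \<open>v\<close>, the edge \<open>f\<close> takes the
      free place. The red component of the entrance loses \<open>v\<close>, and those at earlier
      positions stay the same.\<close>
    define F' t' where "F' = F - {f}" "t' = t(f := v)"
    note defs = F'_t'_def
    have out: "out F' t' y = (if y = v then insert f (out F t v) else out F t y)" for y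
      using f(1) FA by (auto simp: out_def defs)
    have "card (comp F' x) \<le> Suc d" for x
    proof -
      have "card (comp F' x) \<le> card (comp F x)"
        by (intro card_mono finite_comp FE comp_mono) (auto simp: defs)
      also have "\<dots> \<le> Suc d" using col by (simp add: colouring_def)
      finally show ?thesis .
    qed
    moreover have "card (out F' t' y) \<le> cap y" for y
      using out[of y] less.prems(5) col card_insert_le_m1[of "cap v" "out F t v" f]
      by (auto simp: colouring_def split: if_splits)
    ultimately have col': "colouring F' t'"
      using col forest_subset[OF fo, of F'] f(2) FA by (auto simp: colouring_def defs)
    have same: "comp F' (xs ! l) = comp F (xs ! l)" if "l < j" for l
      using comp_delete_other[OF f(1,2)] legal_disjoint[OF leg j _ _ less.prems(4), of l] that j
      by (simp add: defs)
    have "legal F' t' (take (Suc j) xs)"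
      by (rule legal_transfer[OF leg]) (use j same f(1) in \<open>auto simp: defs entry_def\<close>)
    moreover have "comp F' (xs ! j) \<subset> comp F (xs ! j)"
      using comp_mono[of F' F "xs ! j"] f(3) less.prems(4) comp_sym by (auto simp: defs)
    then have "card (comp F' (xs ! j)) < card (comp F (xs ! j))"
      by (intro psubset_card_mono finite_comp FE)
    ultimately show ?thesis using improvesI[OF col' _ j same] False by blast
  next
    case v: True
    show ?thesis
    proof (cases "j = 0")
      case True
      \<comment> \<open>Below its capacity \<open>k + 1\<close>, the vertex \<open>u\<close> has at
        most \<open>k\<close> blue edges, so the defect is gone.\<close>
      then have "v = u" using leg v by (simp add: legal_def)
      then have "card (out F t u) \<le> k" using less.prems(5) by (simp add: cap_def)
      then show ?thesis using col unfolding solved_def by blast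
    next
      case False
      then obtain l g where g: "entry F t xs l j g" using leg j by (auto simp: legal_def)
      then have l: "l < j" "g \<in> A" "g \<notin> F" "ends g = {t g, v}" "t g \<in> comp F (xs ! l)"
        using v by (auto simp: entry_def)
      have neq: "t g \<noteq> v" using l card_ends[of g] A_subset by auto
      define t' where "t' = t(g := v)"
      have out: "out F t' y = (if y = v then insert g (out F t v) else out F t y - {g})" for y
        using l neq by (auto simp: out_def t'_def)
      have "card (out F t' y) \<le> cap y" for y
        using out[of y] less.prems(5) col card_insert_le_m1[of "cap v" "out F t v" g]
          card_Diff1_le[of "out F t y" g]
        by (auto simp: colouring_def split: if_splits intro: order_trans)
      then have col': "colouring F t'" using col l(4) by (auto simp: colouring_def t'_def)
      have "g \<in> out F t (t g)" using l by (simp add: out_def)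
      then have "card (out F t' (t g)) < card (out F t (t g))"
        using out[of "t g"] neq by (metis card_Diff1_less finite_out)
      also have "\<dots> \<le> cap (t g)" using col by (simp add: colouring_def)
      finally have slack: "card (out F t' (t g)) < cap (t g)" .
      \<comment> \<open>Cutting the sequence after \<open>l\<close> drops the entrance served by
        \<open>g\<close>, so reversing \<open>g\<close> does no harm to the rest.\<close>
      have "legal F t' (take (Suc l) xs)"
      proof (rule legal_transfer[OF leg])
        fix l' i e assume i: "i < Suc l" "entry F t xs l' i e"
        have "e \<noteq> g" using entry_head_unique[OF leg i(2), of l j] g i(1) l(1) j by auto
        then show "e \<notin> F \<and> t' e = t e" using i(2) by (auto simp: entry_def t'_def)
      qed (use l(1) j in auto)
      from less.IH[OF l(1) col' this _ _ slack]
      have "solved \<or> (\<exists>i\<le>l. improves F (take (Suc l) xs) i)" using l(1,5) j by auto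
      moreover have "improves F (take (Suc l) xs) i \<longleftrightarrow> improves F xs i" if "i \<le> l" for i
        by (rule improves_cong) (use that in auto)
      ultimately show ?thesis using l(1) by (meson le_less_trans less_imp_le)
    qed
  qed
qed

text \<open>Otherwise it is an improvement to make the entering edge \<open>a\<close> red and the adjacent edge \<open>f\<close>
  blue, leaving \<open>t a\<close>.\<close>

lemma exchange:
  assumes col: "colouring F t" and leg: "legal F t xs" and i: "i < length xs"
    and a: "entry F t xs j i a" and f: "f \<in> F" "ends f = {t a, z}"
    and no: "\<not> improves F xs j"
  shows "xs ! j \<notin> comp (F - {f}) (t a) \<Longrightarrow>
      d + 2 \<le> card (comp (F - {f}) (t a)) + card (comp F (xs ! i))"
    and "xs ! j \<in> comp (F - {f}) (t a) \<Longrightarrow>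
      card (comp (F - {f}) z) \<le> card (comp F (xs ! i))"
proof -
  define x y where "x = t a" "y = xs ! i"
  note xy = x_y_def
  have FE: "F \<subseteq> E" and fo: "forest F" and FA: "F \<subseteq> A"
    using col colouring_subset by (auto simp: colouring_def)
  have ji: "j < i" "a \<in> A" "a \<notin> F" "ends a = {x, y}" "x \<in> comp F (xs ! j)"
    using a by (auto simp: entry_def xy)
  have j: "j < length xs" using ji i by simp
  have yK: "y \<notin> comp F (xs ! j)" using legal_distinct[OF leg i j] ji by (simp add: xy)
  have K: "comp F x = comp F (xs ! j)" using comp_eq[OF ji(5)] .
  have L: "comp (F - {f}) y = comp F y"
    using comp_delete_other[OF f(1)] f(2) yK K comp_sym unfolding xy by blast
  have sub: "comp (F - {f}) p \<subseteq> comp F p" for p by (rule comp_mono) auto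
  define F' t' where "F' = insert a (F - {f})" "t' = t(f := x)"
  note defs = F'_t'_def
  have fE: "F - {f} \<subseteq> E" using FE by auto
  have compx: "comp F' x = comp (F - {f}) x \<union> comp F y"
    using comp_insert[OF ji(4), of "F - {f}"] L by (simp add: defs)
  have comp': "comp F' p = comp (F - {f}) p" if "p \<notin> comp F' x" for p
    using comp_insert_other[OF ji(4), of "F - {f}" p] that compx L comp_sym[of p "F - {f}"]
    by (auto simp: defs)
  have finK: "finite (comp F p)" "finite (comp (F - {f}) p)" for p
    using finite_comp FE fE by auto
  have cardx: "card (comp F' x) \<le> card (comp (F - {f}) x) + card (comp F y)"
    unfolding compx by (rule card_Un_le)
  \<comment> \<open>Red stays a forest, and the blue outdegree of \<open>x\<close> does not grow
    since \<open>a\<close> is traded for \<open>f\<close>. So only the size of the merged component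
    can spoil the new colouring.\<close>
  have key: "\<not> card (comp F' (xs ! j)) < card (comp F (xs ! j))"
    if size: "card (comp (F - {f}) x) + card (comp F y) \<le> Suc d"
  proof
    assume less: "card (comp F' (xs ! j)) < card (comp F (xs ! j))"
    have "forest F'" unfolding defs
      by (rule forest_insert[OF forest_subset[OF fo] ji(4)]) (use sub[of x] yK K in auto)
    moreover have "card (comp F' p) \<le> Suc d" for p
    proof (cases "p \<in> comp F' x")
      case True
      then show ?thesis using comp_eq[OF True] cardx size by simp
    next
      case False
      have "card (comp F' p) \<le> card (comp F p)"
        unfolding comp'[OF False] by (intro card_mono finK sub)
      also have "\<dots> \<le> Suc d" using col by (simp add: colouring_def)
      finally show ?thesis .
    qed
    moreover have "card (out F' t' p) \<le> cap p" for p
    proof (cases "p = x")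
      case True
      have "out F' t' x = insert f (out F t x - {a})"
        using f(1) FA ji by (auto simp: out_def defs xy)
      moreover have "a \<in> out F t x" using ji by (simp add: out_def xy)
      then have "card (insert f (out F t x - {a})) \<le> card (out F t x)"
        by (metis card_insert_le_m1 card_Diff_singleton card_gt_0_iff empty_iff finite_out order_refl)
      ultimately show ?thesis using True col by (metis colouring_def order_trans)
    next
      case False
      then have "out F' t' p = out F t p" using f(1) by (auto simp: out_def defs xy)
      then show ?thesis using col by (simp add: colouring_def)
    qed
    ultimately have col': "colouring F' t'"
      using col f ji(2) by (auto simp: colouring_def defs xy)
    have same: "comp F' (xs ! l) = comp F (xs ! l)" if "l < j" for l
    proof -
      have l: "l < length xs" "l \<noteq> i" "l \<noteq> j" using that ji(1) i by auto
      have "x \<notin> comp F (xs ! l)" "y \<notin> comp F (xs ! l)"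
        using legal_disjoint[OF leg j l(1) _ ji(5)] legal_distinct[OF leg i l(1)] l by (auto simp: xy)
      moreover from this have "xs ! l \<notin> comp F' x"
        unfolding compx using sub[of x] comp_sym by blast
      ultimately show ?thesis using comp' comp_delete_other[OF f(1), of x z "xs ! l"] f(2) by (simp add: xy)
    qed
    have "legal F' t' (take (Suc j) xs)"
    proof (rule legal_transfer[OF leg])
      fix l i' e assume e: "i' < Suc j" "entry F t xs l i' e"
      have "e \<noteq> a" using entry_head_unique[OF leg e(2), of j i] a e(1) ji(1) i by auto
      then show "e \<notin> F' \<and> t' e = t e" using e(2) f(1) by (auto simp: entry_def defs)
    qed (use j same in auto)
    then show False using improvesI[OF col' _ j same less] no by blast
  qed
  \<comment> \<open>Here \<open>f\<close> separates the entrance from \<open>x\<close>, so the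
    component of the entrance loses \<open>x\<close> and shrinks. To prevent an improvement, the
    merged component must be too large.\<close>
  show "d + 2 \<le> card (comp (F - {f}) (t a)) + card (comp F (xs ! i))"
    if out: "xs ! j \<notin> comp (F - {f}) (t a)"
  proof (rule ccontr)
    assume "\<not> ?thesis"
    moreover have "xs ! j \<notin> comp F' x"
      unfolding compx using out yK comp_sym by (auto simp: xy)
    then have "comp F' (xs ! j) \<subset> comp F (xs ! j)"
      using comp' sub[of "xs ! j"] out ji(5) comp_sym unfolding xy by blast
    then have "card (comp F' (xs ! j)) < card (comp F (xs ! j))"
      by (intro psubset_card_mono finK)
    ultimately show False using key by (simp add: xy)
  qed
  \<comment> \<open>Here the entrance stays with \<open>x\<close>, so in its component the part at
    \<open>z\<close> is replaced by the component of \<open>y\<close>. A smaller replacement would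
    be an improvement and would respect the size bound by itself.\<close>
  show "card (comp (F - {f}) z) \<le> card (comp F (xs ! i))"
    if inn: "xs ! j \<in> comp (F - {f}) (t a)"
  proof (rule ccontr)
    assume "\<not> ?thesis"
    then have "card (comp (F - {f}) x) + card (comp F y) < card (comp F x)"
      using forest_delete_card[OF fo FE f] by (simp add: xy)
    moreover have "card (comp F x) \<le> Suc d" using col by (simp add: colouring_def)
    moreover have "comp F' (xs ! j) = comp F' x"
      using inn compx by (intro comp_eq) (auto simp: xy)
    ultimately show False using key cardx K by simp
  qed
qed

text \<open>Making \<open>a\<close> red leaves a free place for a blue edge at the entrance \<open>xs ! j\<close>.\<close>

lemma merge:
  assumes col: "colouring F t" and leg: "legal F t xs" and i: "i < length xs"
    and a: "entry F t xs j i a" "t a = xs ! j"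
    and size: "card (comp F (xs ! j)) + card (comp F (xs ! i)) \<le> Suc d"
  shows "solved \<or> (\<exists>l<j. improves F xs l)"
proof -
  define x y where "x = xs ! j" "y = xs ! i"
  note xy = x_y_def
  have FE: "F \<subseteq> E" and fo: "forest F" and FA: "F \<subseteq> A"
    using col colouring_subset by (auto simp: colouring_def)
  have ji: "j < i" "a \<in> A" "a \<notin> F" "ends a = {x, y}" "t a = x"
    using a by (auto simp: entry_def xy)
  have j: "j < length xs" using ji i by simp
  have yK: "y \<notin> comp F x" using legal_distinct[OF leg i j] ji by (simp add: xy)
  define F' where "F' = insert a F"
  have compx: "comp F' x = comp F x \<union> comp F y" using comp_insert[OF ji(4)] by (simp add: F'_def)
  have comp': "comp F' p = comp F p" if "p \<notin> comp F' x" for p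
    using comp_insert_other[OF ji(4), of F p] that compx comp_sym[of p F] by (auto simp: F'_def)
  have "card (comp F' p) \<le> Suc d" for p
  proof (cases "p \<in> comp F' x")
    case True
    have "card (comp F' x) \<le> card (comp F x) + card (comp F y)" unfolding compx by (rule card_Un_le)
    then show ?thesis using comp_eq[OF True] size by (simp add: xy)
  next
    case False
    then show ?thesis using comp' col by (simp add: colouring_def)
  qed
  moreover have out: "out F' t p = out F t p - {a}" for p by (auto simp: out_def F'_def)
  then have "card (out F' t p) \<le> cap p" for p
    using card_Diff1_le[of "out F t p" a] col by (auto simp: colouring_def intro: order_trans)
  ultimately have col': "colouring F' t"
    using col ji(2) forest_insert[OF fo ji(4) yK] by (auto simp: colouring_def F'_def)
  have same: "comp F' (xs ! l) = comp F (xs ! l)" if "l < j" for l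
  proof -
    have l: "l < length xs" "l \<noteq> i" "l \<noteq> j" using that ji(1) i by auto
    have "xs ! l \<notin> comp F' x"
      unfolding compx using legal_distinct[OF leg l(1) j] legal_distinct[OF leg l(1) i] l by (auto simp: xy)
    then show ?thesis by (rule comp')
  qed
  have "legal F' t (take (Suc j) xs)"
  proof (rule legal_transfer[OF leg])
    fix l i' e assume e: "i' < Suc j" "entry F t xs l i' e"
    have "e \<noteq> a" using entry_head_unique[OF leg e(2), of j i] a e(1) ji(1) i by auto
    then show "e \<notin> F' \<and> t e = t e" using e(2) by (auto simp: entry_def F'_def)
  qed (use j same in auto)
  moreover have "a \<in> out F t x" using ji by (simp add: out_def)
  then have "card (out F' t x) < card (out F t x)" unfolding out by (rule card_Diff1_less[OF finite_out])
  moreover have "card (out F t x) \<le> cap x" using col by (simp add: colouring_def)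
  \<comment> \<open>The free place is at the entrance itself, so \<open>free_place\<close> improves
    strictly before \<open>j\<close>. There the sizes for \<open>F'\<close> and \<open>F\<close>
    agree, while the component at \<open>j\<close> has grown.\<close>
  ultimately have "solved \<or> (\<exists>l<j. improves F' (take (Suc j) xs) l)"
    using free_place[OF col', of "take (Suc j) xs" j x] j by (auto simp: xy)
  moreover have "improves F' (take (Suc j) xs) l \<longleftrightarrow> improves F xs l" if "l < j" for l
    by (rule improves_cong) (use that same in auto)
  ultimately show ?thesis by blast
qed

text \<open>An edge leaving the entrance is handled by \<open>merge\<close>. Otherwise deleting the
  edge \<open>f\<close> from the tail towards the entrance cuts the tail off from it, and
  \<open>exchange\<close> applies. Two trees with \<open>d + 2\<close> vertices have
  \<open>d\<close> edges together.\<close>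

lemma parent_child:
  assumes col: "colouring F t" and leg: "legal F t xs" and i: "i < length xs"
    and a: "entry F t xs j i a"
    and no: "\<not> solved" "\<And>l. l < length xs \<Longrightarrow> \<not> improves F xs l"
  shows "d + 2 \<le> card (comp F (xs ! j)) + card (comp F (xs ! i))"
proof (cases "t a = xs ! j")
  case True
  have "j < i" using a by (simp add: entry_def)
  then show ?thesis using merge[OF col leg i a True] no i by force
next
  case False
  have FE: "F \<subseteq> E" and fo: "forest F" using col colouring_subset by (auto simp: colouring_def)
  have ta: "t a \<in> comp F (xs ! j)" and j: "j < length xs" using a i by (auto simp: entry_def)
  then have "xs ! j \<in> comp F (t a)" using comp_sym by blast
  then obtain f z where f: "f \<in> F" "ends f = {t a, z}" "xs ! j \<notin> comp (F - {f}) (t a)"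
    using edge_towards[OF fo FE _ False] by metis
  have "card (comp (F - {f}) (t a)) \<le> card (comp F (xs ! j))"
    unfolding comp_eq[OF ta, symmetric] by (intro card_mono finite_comp FE comp_mono) auto
  then show ?thesis using exchange(1)[OF col leg i a f(1,2) no(2)[OF j] f(3)] by simp
qed

text \<open>For different tails let \<open>f1\<close> and \<open>f2\<close> point from each tail
  towards the other. The parts \<open>A1\<close> and \<open>A2\<close> cut off at the tails are
  disjoint, so the entrance misses one of them, and \<open>exchange\<close> makes the two children
  too large together. The size hypotheses say that each child has fewer than
  \<open>d / (k + 1)\<close> edges.\<close>

lemma small_children_same_tail:
  assumes col: "colouring F t" and leg: "legal F t xs" and no: "\<not> improves F xs j"
    and i1: "i1 < length xs" "entry F t xs j i1 a1" "Suc k * card (comp F (xs ! i1)) < d + Suc k"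
    and i2: "i2 < length xs" "entry F t xs j i2 a2" "Suc k * card (comp F (xs ! i2)) < d + Suc k"
    and k: "1 \<le> k"
  shows "t a1 = t a2"
proof (rule ccontr)
  assume neq: "t a1 \<noteq> t a2"
  define x1 x2 where "x1 = t a1" "x2 = t a2"
  note xs = x1_x2_def
  have FE: "F \<subseteq> E" and fo: "forest F" using col colouring_subset by (auto simp: colouring_def)
  have K: "comp F x1 = comp F (xs ! j)" "comp F x2 = comp F (xs ! j)"
    using comp_eq i1(2) i2(2) by (auto simp: entry_def xs)
  then have m: "x2 \<in> comp F x1" "x1 \<in> comp F x2" using comp_self by metis+
  obtain f1 z1 where f1: "f1 \<in> F" "ends f1 = {x1, z1}" "x2 \<in> comp (F - {f1}) z1" "x2 \<notin> comp (F - {f1}) x1"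
    using edge_towards[OF fo FE m(1)] neq by (auto simp: xs)
  obtain f2 z2 where f2: "f2 \<in> F" "ends f2 = {x2, z2}" "x1 \<in> comp (F - {f2}) z2" "x1 \<notin> comp (F - {f2}) x2"
    using edge_towards[OF fo FE m(2)] neq by (auto simp: xs)
  define A1 B1 A2 B2 where "A1 = comp (F - {f1}) x1" "B1 = comp (F - {f1}) z1"
    "A2 = comp (F - {f2}) x2" "B2 = comp (F - {f2}) z2"
  note ABs = A1_B1_A2_B2_def
  have dis: "A1 \<inter> A2 = {}"
  proof (cases "f1 = f2")
    case True
    then show ?thesis using comp_disjoint[OF f1(4)] by (simp add: ABs)
  next
    case False
    \<comment> \<open>Walks from \<open>x1\<close> in \<open>F - {f1}\<close> never meet
      \<open>x2\<close>, hence never use \<open>f2\<close>.\<close>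
    have "A1 = comp (F - {f1} - {f2}) x1"
      unfolding ABs by (rule comp_avoid[OF _ _ f1(4)]) (use False f2 in auto)
    also have "\<dots> \<subseteq> comp (F - {f2}) x1" by (rule comp_mono) auto
    finally show ?thesis using comp_disjoint[OF f2(4)] by (auto simp: ABs)
  qed
  have un: "A1 \<union> B1 = comp F (xs ! j)" "A2 \<union> B2 = comp F (xs ! j)"
    using forest_delete_comp(1)[OF fo f1(1,2)] forest_delete_comp(1)[OF fo f2(1,2)] K by (simp_all add: ABs)
  have fin: "finite A1" "finite A2" "finite B1" "finite B2"
    unfolding ABs by (rule finite_comp, use FE in blast)+
  have "card A1 + card A2 = card (A1 \<union> A2)" using dis fin by (simp add: card_Un_disjoint)
  also have "\<dots> \<le> card (comp F (xs ! j))" using un by (intro card_mono finite_comp FE) auto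
  also have "\<dots> \<le> Suc d" using col by (simp add: colouring_def)
  finally have le: "card A1 + card A2 \<le> Suc d" .
  have AB: "card A1 \<le> card B2" "card A2 \<le> card B1"
    using dis un fin by (auto intro!: card_mono)
  note e1 = exchange[OF col leg i1(1,2) f1(1,2)[unfolded xs] no, folded xs, folded ABs]
  note e2 = exchange[OF col leg i2(1,2) f2(1,2)[unfolded xs] no, folded xs, folded ABs]
  \<comment> \<open>Two numbers of edges below \<open>d / (k + 1)\<close> have a sum below
    \<open>d\<close>, as \<open>k\<close> is at least 1.\<close>
  have "Suc k * (card (comp F (xs ! i1)) + card (comp F (xs ! i2))) < 2 * d + 2 * Suc k"
    using i1(3) i2(3) by (simp add: algebra_simps)
  also have "\<dots> \<le> Suc k * d + 2 * Suc k" using k by simp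
  also have "\<dots> = Suc k * (d + 2)" by (simp add: algebra_simps)
  finally have "card (comp F (xs ! i1)) + card (comp F (xs ! i2)) < d + 2" by (simp only: mult_less_cancel1)
  \<comment> \<open>If the entrance is in \<open>A1\<close>, the child at \<open>x1\<close> has at
    least \<open>card B1\<close>, hence at least \<open>card A2\<close> vertices, and the child at
    \<open>x2\<close> at least \<open>d + 2 - card A2\<close>; the case of \<open>A2\<close> is
    symmetric. If it is in neither, the children have at least \<open>2 * (d + 2) - (d + 1)\<close>
    vertices.\<close>
  then show False using e1 e2 dis le AB by (cases "xs ! j \<in> A1"; cases "xs ! j \<in> A2") auto
qed

text \<open>If nothing can be improved, the components of \<open>xs\<close> span too many edges: every vertex has
  all its blue edges inside, and grouping each small component with its parent shows that the red
  edges are dense enough.\<close>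

lemma progress:
  assumes k: "1 \<le> k" and col: "colouring F t" and leg: "legal F t xs"
    and sparse: "\<And>X. finite X \<Longrightarrow>
      (d + k + 1) * card (induced A X) \<le> (k * (d + k + 1) + d) * card X"
  shows "solved \<or> (\<exists>l<length xs. improves F xs l) \<or> (\<exists>h. legal F t (xs @ [h]))"
proof (rule ccontr)
  assume "\<not> ?thesis"
  then have no: "\<not> solved" "\<And>l. l < length xs \<Longrightarrow> \<not> improves F xs l" "\<And>h. \<not> legal F t (xs @ [h])"
    by auto
  have FE: "F \<subseteq> E" and fo: "forest F" and FA: "F \<subseteq> A"
    using col colouring_subset by (auto simp: colouring_def)
  define m where "m = length xs"
  define K where "K i = comp F (xs ! i)" for i
  define X where "X = (\<Union>i<m. K i)"
  define c :: "nat \<Rightarrow> int" where "c i = int (card (K i)) - 1" for i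
  have m0: "0 < m" using leg by (simp add: legal_def m_def)
  have finK: "finite (K i)" for i by (simp add: K_def finite_comp FE)
  have finX: "finite X" using finK by (simp add: X_def)
  have disK: "K i \<inter> K j = {}" if "i < m" "j < m" "i \<noteq> j" for i j
    using comp_disjoint legal_distinct[OF leg] that by (simp add: K_def m_def)
  have u: "u \<in> K 0" using leg by (auto simp: K_def legal_def)
  \<comment> \<open>A free place at a reached vertex would solve the problem or improve the
    sequence.\<close>
  have full: "card (out F t v) = cap v" if "v \<in> X" for v
  proof -
    from that obtain j where "j < m" "v \<in> K j" by (auto simp: X_def)
    then have "\<not> card (out F t v) < cap v"
      using free_place[OF col leg, of j v] no(1,2) by (force simp: m_def K_def)
    then show ?thesis using col by (simp add: colouring_def order.antisym not_less)
  qed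
  \<comment> \<open>Otherwise the head of \<open>e\<close> would be a new entrance prolonging
    \<open>xs\<close>.\<close>
  have closed: "ends e \<subseteq> X" if e: "e \<in> A - F" "t e \<in> X" for e
  proof -
    have "e \<in> E" "t e \<in> ends e" using e col A_subset by (auto simp: colouring_def)
    then obtain h where h: "ends e = {t e, h}" by (rule endsE)
    from e(2) obtain l where l: "l < m" "t e \<in> K l" by (auto simp: X_def)
    have "h \<in> X"
    proof (rule ccontr)
      assume hX: "h \<notin> X"
      have "legal F t (xs @ [h])"
        unfolding legal_def
      proof (intro conjI allI impI)
        show "xs @ [h] \<noteq> []" "(xs @ [h]) ! 0 = u" using leg by (auto simp: legal_def nth_append)
      next
        fix i j assume "i < length (xs @ [h])" "j < i"
        then show "(xs @ [h]) ! i \<notin> comp F ((xs @ [h]) ! j)"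
          using hX leg by (cases "i = length xs") (auto simp: nth_append legal_def X_def K_def m_def)
      next
        fix i assume i: "i < length (xs @ [h])" "0 < i"
        show "\<exists>l e. entry F t (xs @ [h]) l i e"
        proof (cases "i < length xs")
          case True
          then obtain l e where "entry F t xs l i e" using leg i by (auto simp: legal_def)
          then have "entry F t (xs @ [h]) l i e" using True by (auto simp: entry_def nth_append)
          then show ?thesis by blast
        next
          case False
          then have "i = length xs" using i by simp
          then have "entry F t (xs @ [h]) l i e"
            using l e h by (simp add: entry_def nth_append K_def m_def)
          then show ?thesis by blast
        qed
      qed
      then show False using no(3) by blast
    qed
    then show ?thesis using h e(2) by simp
  qed
  have cardX: "card X = (\<Sum>i<m. card (K i))"
    unfolding X_def by (rule card_UN_disjoint) (use finK disK in auto)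
  have Kpos: "0 < card (K i)" for i
    using finK[of i] comp_self by (metis K_def card_gt_0_iff empty_iff)
  have nX: "int (card X) = (\<Sum>i<m. c i) + int m"
    by (simp add: cardX c_def sum_subtractf)
  \<comment> \<open>There are \<open>k * card X + 1\<close> blue edges, the surplus coming from
    \<open>u\<close>, and \<open>card X - m\<close> red ones, as the red components are
    \<open>m\<close> trees.\<close>
  define Bl where "Bl = (\<Union>v\<in>X. out F t v)"
  define R where "R = (\<Union>i<m. induced F (K i))"
  have uX: "u \<in> X" using u m0 by (auto simp: X_def)
  have "card Bl = (\<Sum>v\<in>X. card (out F t v))"
    unfolding Bl_def by (rule card_UN_disjoint) (use finX in \<open>simp, simp, auto simp: out_def\<close>)
  also have "\<dots> = (\<Sum>v\<in>X. cap v)" by (rule sum.cong) (use full in auto)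
  also have "\<dots> = k * card X + 1"
    using finX uX by (simp add: cap_def sum.distrib sum.delta')
  finally have cardBl: "card Bl = k * card X + 1" .
  have finF: "finite F" "finite A" using finite_subset[OF _ finite_E] FE A_subset by auto
  have "card R = (\<Sum>i<m. card (induced F (K i)))"
    unfolding R_def
  proof (rule card_UN_disjoint)
    show "\<forall>i\<in>{..<m}. \<forall>j\<in>{..<m}. i \<noteq> j \<longrightarrow> induced F (K i) \<inter> induced F (K j) = {}"
    proof (intro ballI impI equals0I)
      fix i j e assume "i \<in> {..<m}" "j \<in> {..<m}" "i \<noteq> j" "e \<in> induced F (K i) \<inter> induced F (K j)"
      then have "e \<in> E" "ends e \<subseteq> {}" using FE disK[of i j] by (auto simp: induced_def)
      then show False using card_ends[of e] by simp
    qed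
  qed (use finF in \<open>auto simp: induced_def\<close>)
  moreover have "int (card (induced F (K i))) = c i" for i
    using forest_card_comp[OF FE fo, of "xs ! i"] by (simp add: c_def K_def)
  ultimately have cardR: "int (card R) = (\<Sum>i<m. c i)" by simp
  have "Bl \<union> R \<subseteq> induced A X"
    using closed FA by (fastforce simp: Bl_def R_def out_def induced_def X_def)
  then have "card (Bl \<union> R) \<le> card (induced A X)"
    using finF by (intro card_mono) (auto simp: induced_def)
  moreover have "Bl \<inter> R = {}" by (auto simp: Bl_def R_def out_def induced_def)
  moreover have "finite Bl" "finite R" using finX finF by (auto simp: Bl_def R_def induced_def)
  ultimately have "card Bl + card R \<le> card (induced A X)" by (simp add: card_Un_disjoint)
  then have "(d + k + 1) * (card Bl + card R) \<le> (d + k + 1) * card (induced A X)" by (rule mult_le_mono2)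
  also have "\<dots> \<le> (k * (d + k + 1) + d) * card X" by (rule sparse[OF finX])
  finally have "int ((d + k + 1) * (card Bl + card R)) \<le> int ((k * (d + k + 1) + d) * card X)"
    by (simp only: of_nat_le_iff)
  \<comment> \<open>With \<open>card X\<close> written as the number of red edges plus
    \<open>m\<close>, the multiples of \<open>k * (d + k + 1)\<close> cancel. So the charges sum to
    at most \<open>- (d + k + 1)\<close>, whereas \<open>charge_bound\<close> gives at least
    \<open>- d\<close>.\<close>
  then have "int (d + k + 1) + (int k + 1) * (\<Sum>i<m. c i) \<le> int d * int m"
    unfolding cardBl of_nat_mult of_nat_add cardR nX by (simp add: algebra_simps)
  moreover have "(\<Sum>i<m. (int k + 1) * c i - int d) = (int k + 1) * (\<Sum>i<m. c i) - int d * int m"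
    by (simp add: sum_subtractf sum_distrib_left)
  moreover have "- int d \<le> (\<Sum>i<m. (int k + 1) * c i - int d)"
  proof -
    obtain p a where pa: "\<And>i. i \<in> {1..<m} \<Longrightarrow> entry F t xs (p i) i (a i)"
      using leg unfolding legal_def m_def
      by (metis One_nat_def Suc_le_lessD atLeastLessThan_iff)
    show ?thesis
    proof (rule charge_bound[OF m0 k, of p])
      fix i assume i: "i \<in> {1..<m}"
      show "p i < m" using pa[OF i] i by (simp add: entry_def)
      have "d + 2 \<le> card (K (p i)) + card (K i)"
        using parent_child[OF col leg _ pa[OF i] no(1,2)] i by (simp add: K_def m_def)
      then show "int d \<le> c (p i) + c i" by (simp add: c_def)
    next
      fix j assume j: "j < m"
      let ?S = "{i \<in> {1..<m}. (int k + 1) * c i < int d \<and> p i = j}"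
      show "card ?S \<le> k + (if j = 0 then 1 else 0)"
      proof (cases "?S = {}")
        case False
        then obtain i0 where i0: "i0 \<in> ?S" by blast
        have small: "Suc k * card (comp F (xs ! i)) < d + Suc k" if "i \<in> ?S" for i
        proof -
          have "int (Suc k * card (K i)) < int (d + Suc k)"
            using that by (simp add: c_def algebra_simps)
          then show ?thesis by (simp only: of_nat_less_iff K_def)
        qed
        have entry: "entry F t xs j i (a i)" "i < length xs" if "i \<in> ?S" for i
          using pa[of i] that by (auto simp: m_def)
        \<comment> \<open>All small children of \<open>j\<close> hang at one vertex. Their entering
          edges are distinct blue edges leaving it, so its capacity bounds their number.\<close>
        have "\<not> improves F xs j" using no(2) j by (simp add: m_def)
        then have tails: "t (a i) = t (a i0)" if "i \<in> ?S" for i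
          by (rule small_children_same_tail[OF col leg _ entry(2,1)[OF that] small[OF that]
                entry(2,1)[OF i0] small[OF i0] k])
        have "a i \<in> out F t (t (a i0))" if "i \<in> ?S" for i
          using tails[OF that] entry(1)[OF that] by (simp add: out_def entry_def)
        then have "a ` ?S \<subseteq> out F t (t (a i0))" by (rule image_subsetI)
        moreover have "inj_on a ?S"
        proof (rule inj_onI)
          fix i i' assume ii: "i \<in> ?S" "i' \<in> ?S" "a i = a i'"
          show "i = i'"
            by (rule entry_head_unique[OF leg entry(1)[OF ii(1)] entry(1)[OF ii(2), folded ii(3)]
                  entry(2)[OF ii(1)] entry(2)[OF ii(2)]])
        qed
        ultimately have "card ?S \<le> card (out F t (t (a i0)))"
          by (intro card_inj_on_le[of a] finite_out)
        also have "\<dots> \<le> cap (t (a i0))" using col by (simp add: colouring_def)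
        \<comment> \<open>Only \<open>u\<close> has capacity \<open>k + 1\<close>, and
          \<open>u\<close> lies in the first component.\<close>
        also have "\<dots> \<le> k + (if j = 0 then 1 else 0)"
        proof -
          have "t (a i0) \<in> K j" using pa[of i0] i0 by (auto simp: entry_def K_def)
          then have "t (a i0) = u \<Longrightarrow> j = 0" using disK[of j 0] u j m0 by auto
          then show ?thesis by (auto simp: cap_def)
        qed
        finally show ?thesis .
      next
        case True
        then show ?thesis by (simp only: card.empty le0)
      qed
    qed (use Kpos in \<open>simp add: c_def Suc_le_eq\<close>)
  qed
  ultimately show False by linarith
qed

section \<open>Termination of the recolouring\<close>

lemma length_legal_le:
  assumes "legal F t xs"
  shows "length xs \<le> card (insert u (\<Union>e\<in>E. ends e))"
proof -
  have "distinct xs"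
    unfolding distinct_conv_nth using legal_distinct[OF assms] comp_self by metis
  moreover have "set xs \<subseteq> insert u (\<Union>e\<in>E. ends e)"
  proof
    fix x assume "x \<in> set xs"
    then obtain i where i: "i < length xs" "x = xs ! i" by (auto simp: in_set_conv_nth)
    show "x \<in> insert u (\<Union>e\<in>E. ends e)"
    proof (cases "i = 0")
      case True
      then show ?thesis using assms i by (simp add: legal_def)
    next
      case False
      then obtain l e where "entry F t xs l i e" using assms i by (auto simp: legal_def)
      then show ?thesis using i A_subset by (auto simp: entry_def)
    qed
  qed
  moreover have "finite (insert u (\<Union>e\<in>E. ends e))" using finite_E finite_ends by simp
  ultimately show ?thesis using card_mono distinct_card by metis
qed

lemma colouring_solved:
  assumes k: "1 \<le> k" and col: "colouring F t"
    and sparse: "\<And>X. finite X \<Longrightarrow>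
      (d + k + 1) * card (induced A X) \<le> (k * (d + k + 1) + d) * card X"
  shows solved
proof -
  define N where "N = card (insert u (\<Union>e\<in>E. ends e))"
  \<comment> \<open>The padding \<open>d + 2\<close> exceeds every red component size, so prolonging
    the sequence also lowers the list. The fixed length \<open>N\<close> makes the lexicographic
    order well-founded.\<close>
  define M where "M F xs =
    map (\<lambda>i. if i < length xs then card (comp F (xs ! i)) else d + 2) [0..<N]" for F xs
  have len: "length (M F xs) = N" for F xs by (simp add: M_def)
  have "colouring F t \<Longrightarrow> legal F t xs \<Longrightarrow> L = M F xs \<Longrightarrow> solved" for L F t xs
  proof (induction L arbitrary: F t xs rule: wf_induct_rule[OF wf_lexn[OF wf_less_than, of N]])
    case (1 L)
    note col = 1(2) and leg = 1(3) and L = 1(4)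
    consider "solved" | l where "l < length xs" "improves F xs l" | h where "legal F t (xs @ [h])"
      using progress[OF k col leg sparse] by blast
    then show ?case
    proof cases
      case 2
      then obtain F' t' xs' where new: "colouring F' t'" "legal F' t' xs'" "l < length xs'"
        "\<And>j. j < l \<Longrightarrow> card (comp F' (xs' ! j)) = card (comp F (xs ! j))"
        "card (comp F' (xs' ! l)) < card (comp F (xs ! l))"
        unfolding improves_def by blast
      have "l < N" using length_legal_le[OF leg] 2 by (simp add: N_def)
      then have "(M F' xs', M F xs) \<in> lexn less_than N"
        by (intro lexn_nthI[of _ _ _ l] len) (use new 2 in \<open>auto simp: M_def\<close>)
      then show ?thesis using 1(1)[OF _ new(1,2) refl] L by simp
    next
      case 3
      have "length xs < N" using length_legal_le[OF 3] by (simp add: N_def)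
      moreover have "card (comp F h) < d + 2"
        using col by (auto simp: colouring_def less_Suc_eq_le)
      ultimately have "(M F (xs @ [h]), M F xs) \<in> lexn less_than N"
        by (intro lexn_nthI[of _ _ _ "length xs"] len) (auto simp: M_def nth_append)
      then show ?thesis using 1(1)[OF _ col 3 refl] L by simp
    qed simp
  qed
  moreover have "legal F t [u]" by (simp add: legal_def)
  ultimately show ?thesis using col by blast
qed

end

section \<open>Decomposing the graph\<close>

context edge_graph
begin

text \<open>For \<open>k = 0\<close> there are no blue edges, and the density alone bounds the components.\<close>

lemma ex_forest_orientation:
  assumes sparse: "\<And>X. finite X \<Longrightarrow>
      (d + k + 1) * card (induced E X) \<le> (k * (d + k + 1) + d) * card X"
    and "A \<subseteq> E"
  shows "\<exists>F t. F \<subseteq> A \<and> forest F \<and> (\<forall>e\<in>A. t e \<in> ends e) \<and>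
    (\<forall>x. card (comp F x) \<le> Suc d) \<and> (\<forall>v. card {e \<in> A - F. t e = v} \<le> k)"
proof -
  have "finite A" using assms(2) finite_E by (rule finite_subset)
  then show ?thesis using assms(2)
  proof (induction A rule: finite_induct)
    case empty
    have "comp {} x = {x}" for x using comp_subset[of "{}" x] comp_self[of x "{}"] by auto
    then show ?case by (intro exI[of _ "{}"]) (simp add: forest_def)
  next
    case (insert a A)
    then have A: "A \<subseteq> E" "insert a A \<subseteq> E" "a \<in> E" by auto
    from insert.IH[OF A(1)] obtain F t where F: "F \<subseteq> A" "forest F" "\<forall>e\<in>A. t e \<in> ends e"
      "\<forall>x. card (comp F x) \<le> Suc d" "\<forall>v. card {e \<in> A - F. t e = v} \<le> k" by blast
    have sparse': "(d + k + 1) * card (induced A' X) \<le> (k * (d + k + 1) + d) * card X"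
      if "finite X" "A' \<subseteq> E" for A' X
    proof -
      have "card (induced A' X) \<le> card (induced E X)"
        using that finite_E by (intro card_mono) (auto simp: induced_def)
      then show ?thesis using sparse[OF that(1)] by (meson le_trans mult_le_mono2)
    qed
    obtain p where "p \<in> ends a" using card_ends[OF A(3)] by fastforce
    then obtain q where a: "ends a = {p, q}" using A(3) endsE by metis
    show ?case
    proof (cases "1 \<le> k")
      case True
      \<comment> \<open>The new edge starts blue and leaves \<open>p\<close>, which takes the role
        of the vertex with the defect.\<close>
      interpret recolouring ends E "insert a A" k d p
        by unfold_locales (rule A(2))
      define B where "B v = {e \<in> A - F. t e = v} \<union> (if v = p then {a} else {})" for v
      have "card (out F (t(a := p)) v) \<le> cap v" for v
      proof -
        have "out F (t(a := p)) v \<subseteq> B v" by (auto simp: out_def B_def)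
        then have "card (out F (t(a := p)) v) \<le> card (B v)"
          using insert.hyps by (intro card_mono) (auto simp: B_def)
        also have "\<dots> \<le> card {e \<in> A - F. t e = v} + card (if v = p then {a} else {})"
          unfolding B_def by (rule card_Un_le)
        also have "\<dots> \<le> cap v" using F(5) by (simp add: cap_def)
        finally show ?thesis .
      qed
      then have "colouring F (t(a := p))" using F a by (auto simp: colouring_def)
      then have solved using colouring_solved[OF True _ sparse'] A(2) by blast
      then obtain F' t' where new: "colouring F' t'" "card (out F' t' p) \<le> k"
        by (auto simp: solved_def)
      have "card (out F' t' v) \<le> k" for v
        using new by (cases "v = p") (auto simp: colouring_def cap_def dest!: spec[of _ v])
      then show ?thesis using new(1) unfolding colouring_def out_def by blast
    next
      case False
      then have "k = 0" by simp
      have "A - F = {}"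
      proof (rule equals0I)
        fix e assume "e \<in> A - F"
        then have "e \<in> {e' \<in> A - F. t e' = t e}" by simp
        moreover have "finite {e' \<in> A - F. t e' = t e}" using insert.hyps by simp
        ultimately show False using F(5) \<open>k = 0\<close> by (metis card_0_eq empty_iff le_zero_eq)
      qed
      then have FA: "F = A" using F(1) by blast
      \<comment> \<open>For \<open>k = 0\<close> the density bounds \<open>d + 1\<close> times the
        edges by \<open>d\<close> times the vertices, but closing a cycle would give a component
        with as many edges as vertices.\<close>
      have q: "q \<notin> comp F p"
      proof
        assume q: "q \<in> comp F p"
        have "induced (insert a A) (comp F p) = insert a (induced F (comp F p))"
          using a q by (auto simp: induced_def FA)
        moreover have "a \<notin> induced F (comp F p)" "finite (induced F (comp F p))"
          using insert.hyps by (auto simp: induced_def FA)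
        ultimately have "card (induced (insert a A) (comp F p)) = card (comp F p)"
          using forest_card_comp[of F p] F(2) A(1) FA by simp
        then have "card (comp F p) = 0"
          using sparse'[OF finite_comp A(2), of F p] A(1) \<open>k = 0\<close> by (simp add: FA)
        then show False using finite_comp[of F p] A(1) FA comp_self by (metis card_0_eq empty_iff)
      qed
      have forest: "forest (insert a A)" using forest_insert[OF F(2) a q] by (simp add: FA)
      \<comment> \<open>For a tree on \<open>n\<close> vertices the density gives
        \<open>(d + 1) * (n - 1) \<le> d * n\<close>, that is \<open>n \<le> d + 1\<close>.\<close>
      have "card (comp (insert a A) x) \<le> Suc d" for x
        using sparse'[OF finite_comp A(2), of "insert a A" x, OF A(2)]
          forest_card_comp[OF A(2) forest, of x] \<open>k = 0\<close> by simp
      then show ?thesis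
        using forest F(3) a \<open>k = 0\<close>
        by (intro exI[of _ "insert a A"] exI[of _ "t(a := p)"]) auto
    qed
  qed
qed

section \<open>Cycles and pseudoforests\<close>

lemma cycle_reach:
  assumes n: "length vs = n" "length es = n" "distinct es" "i < n"
    and ends: "\<And>i. i < n \<Longrightarrow> ends (es ! i) = {vs ! i, vs ! (Suc i mod n)}"
  shows "(vs ! i, vs ! (Suc i mod n)) \<in> reach (set es - {es ! i})"
proof -
  \<comment> \<open>From the far end of \<open>es ! i\<close>, going \<open>m < n\<close> steps
    forward avoids \<open>es ! i\<close>; for \<open>m = n - 1\<close> the walk ends at
    \<open>vs ! i\<close>.\<close>
  have "(vs ! (Suc i mod n), vs ! ((Suc i + m) mod n)) \<in> reach (set es - {es ! i})" if "m < n" for m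
    using that
  proof (induction m)
    case (Suc m)
    let ?j = "(Suc i + m) mod n"
    have j: "?j < n" using n by simp
    have "?j \<noteq> i" using Suc.prems n(4) by (auto simp: mod_if)
    then have "es ! ?j \<in> set es - {es ! i}" using n j by (simp add: nth_eq_iff_index_eq)
    moreover have "ends (es ! ?j) = {vs ! ?j, vs ! ((Suc i + Suc m) mod n)}"
      using ends[OF j] by (simp add: mod_Suc_eq)
    ultimately show ?case using Suc by (meson Suc_lessD reach_edge reach_trans)
  qed simp
  from this[of "n - 1"] show ?thesis using n(4) reach_sym by simp
qed

end

lemma cycle_graph_reach:
  assumes "cycle_graph C" "e \<in> edges C" "ends C e = {x, y}"
  shows "(x, y) \<in> edge_graph.reach (ends C) (edges C - {e})"
proof -
  from assms(1) obtain vs es where c: "length es = length vs" "distinct es" "edges C = set es"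
    "\<And>i. i < length vs \<Longrightarrow> ends C (es ! i) = {vs ! i, vs ! (Suc i mod length vs)}"
    "length vs \<ge> 2" "distinct vs"
    unfolding cycle_graph_def by blast
  interpret edge_graph "ends C" "set es"
  proof
    fix e assume "e \<in> set es"
    then obtain i where i: "i < length vs" "e = es ! i" using c(1) by (auto simp: in_set_conv_nth)
    have "i \<noteq> Suc i mod length vs" "Suc i mod length vs < length vs"
      using i c(5) by (auto simp: mod_Suc)
    then have "vs ! i \<noteq> vs ! (Suc i mod length vs)" using i c(6) by (simp add: nth_eq_iff_index_eq)
    then show "card (ends C e) = 2" using c(4) i by simp
  qed simp
  obtain i where i: "i < length vs" "e = es ! i" using assms(2) c(1,3) by (auto simp: in_set_conv_nth)
  from cycle_reach[OF refl c(1,2) i(1) c(4)]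
  have "(vs ! i, vs ! (Suc i mod length vs)) \<in> reach (edges C - {e})" by (simp add: i c(3))
  then show ?thesis using assms(3) c(4)[OF i(1)] i(2) reach_sym by (auto simp: doubleton_eq_iff)
qed

text \<open>As subgraphs of one graph share \<open>ends\<close>, this makes a cycle determined by
  its edge set.\<close>

lemma cycle_graph_verts:
  assumes "cycle_graph C"
  shows "verts C = (\<Union>e\<in>edges C. ends C e)" "edges C \<noteq> {}"
proof -
  from assms obtain vs es where c: "length es = length vs" "edges C = set es" "verts C = set vs"
    "\<And>i. i < length vs \<Longrightarrow> ends C (es ! i) = {vs ! i, vs ! (Suc i mod length vs)}"
    "length vs \<ge> 2"
    unfolding cycle_graph_def by blast
  have "(\<Union>e\<in>edges C. ends C e) = (\<Union>i<length vs. {vs ! i, vs ! (Suc i mod length vs)})"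
    unfolding c(2) set_conv_nth c(1) using c(4) by (auto simp: lessThan_def)
  also have "\<dots> = set vs"
  proof
    have "Suc i mod length vs < length vs" for i using c(5) by (intro mod_less_divisor) linarith
    then show "(\<Union>i<length vs. {vs ! i, vs ! (Suc i mod length vs)}) \<subseteq> set vs" by auto
  qed (auto simp: in_set_conv_nth)
  finally show "verts C = (\<Union>e\<in>edges C. ends C e)" using c(3) by simp
  show "edges C \<noteq> {}" using c(1,2,5) by auto
qed

lemma finite_multigraph_edge_graph: "finite_multigraph G \<Longrightarrow> edge_graph (ends G) (edges G)"
  by (simp add: edge_graph_def finite_multigraph_def finite_multigraph_axioms_def multigraph_def)

lemma connected_verts:
  assumes "finite_multigraph G" "subgraph K G" "connected_graph K" "x \<in> verts K"
  shows "verts K = edge_graph.comp (ends G) (edges K) x"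
proof -
  interpret edge_graph "ends G" "edges G" using assms(1) by (rule finite_multigraph_edge_graph)
  have K: "multigraph K" "ends K = ends G" using assms(2) by (auto simp: subgraph_def)
  have "verts K \<subseteq> comp (edges K) x"
    using assms(3,4) unfolding connected_graph_def comp_def reach_def K by blast
  moreover have "comp (edges K) x \<subseteq> verts K"
    using comp_subset[of "edges K" x] assms(4) multigraph.ends_subset[OF K(1)] K(2) by fastforce
  ultimately show ?thesis by simp
qed

text \<open>A connected graph with two cycles has more edges than vertices, because it stays connected
  when one suitable edge of each is deleted.\<close>

lemma pseudoforest_if_inj_tails:
  assumes fin: "finite_multigraph G" and inj: "inj_on t (edges G)"
    and t: "\<And>e. e \<in> edges G \<Longrightarrow> t e \<in> ends G e"
  shows "pseudoforest G"
  unfolding pseudoforest_def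
proof (intro conjI allI impI)
  show "multigraph G" using fin by (simp add: finite_multigraph_def)
next
  fix K assume "connected_component K G"
  then have K: "subgraph K G" "connected_graph K" by (auto simp: connected_component_def)
  then obtain x where x: "x \<in> verts K" by (auto simp: connected_graph_def)
  interpret edge_graph "ends G" "edges G" using fin by (rule finite_multigraph_edge_graph)
  note vK = connected_verts[OF fin K x]
  have sub: "edges K \<subseteq> edges G" "verts K \<subseteq> verts G" "ends K = ends G" "multigraph K"
    using K(1) by (auto simp: subgraph_def)
  have fK: "finite (edges K)" "finite (verts K)"
    using sub fin finite_subset by (auto simp: finite_multigraph_def finite_multigraph_axioms_def)
  have "t ` edges K \<subseteq> verts K"
    using t sub multigraph.ends_subset[OF sub(4)] by fastforce
  then have ev: "card (edges K) \<le> card (verts K)"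
    using card_inj_on_le[OF inj_on_subset[OF inj sub(1)] _ fK(2)] by blast
  have del: "comp (F - {e}) x = comp F x"
    if C: "subgraph C K" "cycle_graph C" and e: "e \<in> edges C" "edges C \<subseteq> F" "F \<subseteq> edges G" for C F e
  proof -
    have "e \<in> edges G" using e by auto
    then obtain p q where pq: "ends G e = {p, q}" using card_ends by (meson card_2_iff)
    have "ends C = ends G" using C(1) sub(3) by (simp add: subgraph_def)
    then have "(p, q) \<in> reach (edges C - {e})" using cycle_graph_reach[OF C(2) e(1)] pq by simp
    then have "(p, q) \<in> reach (F - {e})" by (rule reach_mono[rotated]) (use e in auto)
    then show ?thesis using comp_delete[OF _ pq] e by auto
  qed
  \<comment> \<open>After deleting \<open>e\<close>, the cycle \<open>C'\<close> is still intact, so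
    one of its edges \<open>e'\<close> can go too. The remaining \<open>card (edges K) - 2\<close>
    edges connect all of \<open>verts K\<close>, so \<open>K\<close> has more edges than vertices,
    against \<open>ev\<close>.\<close>
  have no: False
    if C: "subgraph C K" "cycle_graph C" "subgraph C' K" "cycle_graph C'"
      and e: "e \<in> edges C" "e \<notin> edges C'" for C C' e
  proof -
    obtain e' where e': "e' \<in> edges C'" using cycle_graph_verts(2)[OF C(4)] by blast
    have sC: "edges C \<subseteq> edges K" "edges C' \<subseteq> edges K" using C by (auto simp: subgraph_def)
    have c: "comp (edges K - {e} - {e'}) x = verts K"
      using del[OF C(3,4) e', of "edges K - {e}"] del[OF C(1,2) e(1) sC(1) sub(1)] sC e sub(1) vK by auto
    have "e \<noteq> e'" "e \<in> edges K" "e' \<in> edges K" using e e' sC by auto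
    then have "card {e, e'} \<le> card (edges K)" "card (edges K - {e} - {e'}) = card (edges K) - 2"
      using fK by (auto intro!: card_mono simp del: card_insert_disjoint)
    moreover have "card (verts K) \<le> Suc (card (edges K - {e} - {e'}))"
    proof -
      have "card (verts K) \<le> Suc (card (induced (edges K - {e} - {e'}) (verts K)))"
        using card_comp_le[of "edges K - {e} - {e'}" x] sub(1) unfolding c by blast
      also have "card (induced (edges K - {e} - {e'}) (verts K)) \<le> card (edges K - {e} - {e'})"
        using fK by (intro card_mono) (auto simp: induced_def)
      finally show ?thesis by simp
    qed
    ultimately show False using ev \<open>e \<noteq> e'\<close> by simp
  qed
  show "\<exists>\<^sub>\<le>\<^sub>1 C. subgraph C K \<and> cycle_graph C"
  proof (rule Uniq_I, elim conjE)
    fix C C' assume C: "subgraph C K" "cycle_graph C" "subgraph C' K" "cycle_graph C'"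
    then have "edges C = edges C'" using no by blast
    moreover have "ends C = ends C'" using C by (simp add: subgraph_def)
    ultimately show "C = C'" using cycle_graph_verts(1)[OF C(2)] cycle_graph_verts(1)[OF C(4)] by simp
  qed
qed

text \<open>No edge of a cycle is a bridge, so a forest contains no cycle at all.\<close>

lemma pseudoforest_if_forest:
  assumes fin: "finite_multigraph G" and forest: "edge_graph.forest (ends G) (edges G)"
  shows "pseudoforest G"
  unfolding pseudoforest_def
proof (intro conjI allI impI)
  show "multigraph G" using fin by (simp add: finite_multigraph_def)
next
  fix K assume "connected_component K G"
  then have K: "subgraph K G" by (simp add: connected_component_def)
  interpret edge_graph "ends G" "edges G" using fin by (rule finite_multigraph_edge_graph)
  have False if C: "subgraph C K" "cycle_graph C" for C
  proof -
    have sub: "edges C \<subseteq> edges G" "ends C = ends G" using C(1) K by (auto simp: subgraph_def)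
    obtain e where e: "e \<in> edges C" using cycle_graph_verts(2)[OF C(2)] by blast
    then obtain p q where pq: "ends G e = {p, q}" using card_ends sub by (meson card_2_iff subsetD)
    have "(p, q) \<in> reach (edges C - {e})" using cycle_graph_reach[OF C(2) e] pq sub(2) by simp
    then have "(p, q) \<in> reach (edges G - {e})" by (rule reach_mono[rotated]) (use sub in auto)
    then show False using forest e sub pq unfolding forest_def by blast
  qed
  then show "\<exists>\<^sub>\<le>\<^sub>1 C. subgraph C K \<and> cycle_graph C" by (auto simp: Uniq_def)
qed

lemma forest_component_edges:
  assumes fin: "finite_multigraph G" and forest: "edge_graph.forest (ends G) (edges G)"
    and comps: "\<And>x. card (edge_graph.comp (ends G) (edges G) x) \<le> Suc d"
    and C: "connected_component C G"
  shows "card (edges C) \<le> d"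
proof -
  interpret edge_graph "ends G" "edges G" using fin by (rule finite_multigraph_edge_graph)
  have C: "subgraph C G" "connected_graph C" using C by (auto simp: connected_component_def)
  then obtain x where x: "x \<in> verts C" by (auto simp: connected_graph_def)
  have sub: "edges C \<subseteq> edges G" "ends C = ends G" "multigraph C"
    using C(1) by (auto simp: subgraph_def)
  have "induced (edges C) (verts C) = edges C"
    using multigraph.ends_subset[OF sub(3)] sub(2) by (auto simp: induced_def)
  then have "Suc (card (edges C)) = card (comp (edges C) x)"
    using forest_card_comp[OF sub(1) forest_subset[OF forest sub(1)], of x]
      connected_verts[OF fin C x] by simp
  also have "\<dots> \<le> card (comp (edges G) x)" by (intro card_mono finite_comp comp_mono sub) simp
  also have "\<dots> \<le> Suc d" by (rule comps)
  finally show ?thesis by simp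
qed

section \<open>From the average degree to the decomposition\<close>

lemma mad_le_sparse:
  assumes fin: "finite_multigraph G"
    and mad: "mad G \<le> 2 * real k + 2 * real d / (real d + real k + 1)"
    and X: "finite X"
  shows "(d + k + 1) * card (edge_graph.induced (ends G) (edges G) X)
    \<le> (k * (d + k + 1) + d) * card X"
proof -
  interpret edge_graph "ends G" "edges G" using fin by (rule finite_multigraph_edge_graph)
  interpret finite_multigraph G by (rule fin)
  \<comment> \<open>\<open>X\<close> may contain elements that are not vertices; intersecting with
    \<open>verts G\<close> loses no induced edge. If nothing remains, \<open>mad\<close> gives no
    bound, but then no edge is induced.\<close>
  define H where "H = \<lparr>verts = X \<inter> verts G, edges = induced (edges G) X, ends = ends G\<rparr>"
  have H: "subgraph H G"
    using ends_subset card_ends by (auto simp: H_def subgraph_def multigraph_def induced_def)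
  show ?thesis
  proof (cases "X \<inter> verts G = {}")
    case True
    have "induced (edges G) X = {}"
    proof (rule equals0I)
      fix e assume "e \<in> induced (edges G) X"
      then have "e \<in> edges G" "ends G e \<subseteq> {}" using ends_subset True by (auto simp: induced_def)
      then show False using card_ends[of e] by simp
    qed
    then show ?thesis by simp
  next
    case False
    then have "0 < card (X \<inter> verts G)" using X by (simp add: card_gt_0_iff)
    define r where "r = real k + real d / (real d + real k + 1)"
    have "2 * real (card (induced (edges G) X)) / real (card (X \<inter> verts G)) \<le> 2 * r"
      using subgraph_average_le_mad[OF H] mad False by (simp add: H_def r_def)
    then have "real (card (induced (edges G) X)) \<le> r * real (card (X \<inter> verts G))"
      using \<open>0 < card (X \<inter> verts G)\<close> by (simp add: pos_divide_le_eq)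
    also have "\<dots> \<le> (real k + real d / (real d + real k + 1)) * real (card X)"
      unfolding r_def
      using X by (intro mult_left_mono) (auto intro: card_mono)
    finally have "real (d + k + 1) * real (card (induced (edges G) X)) \<le>
        real (d + k + 1) * ((real k + real d / (real d + real k + 1)) * real (card X))"
      by (intro mult_left_mono) auto
    also have "\<dots> = real ((k * (d + k + 1) + d) * card X)"
      by (simp add: field_simps)
    finally show ?thesis by (simp only: of_nat_mult[symmetric] of_nat_le_iff)
  qed
qed

theorem theorem1p8:
  fixes k d :: nat
    and G :: "('v, 'e) pre_multigraph"
  assumes "d \<ge> 1"
    and "d \<le> 2 * k + 2"
    and "finite_multigraph G"
    and "mad G \<le> 2 * real k + 2 * real d / (real d + real k + 1)"
  shows "\<exists>H :: nat \<Rightarrow> ('v, 'e) pre_multigraph.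
    decomposition G {..<k + 1} H \<and>
    (\<forall>i<k + 1. pseudoforest (H i)) \<and>
    (\<exists>i<k + 1. \<forall>C. connected_component C (H i) \<longrightarrow> card (edges C) \<le> d)"
proof -
  interpret edge_graph "ends G" "edges G" using assms(3) by (rule finite_multigraph_edge_graph)
  interpret finite_multigraph G by (rule assms(3))
  obtain F t where F: "F \<subseteq> edges G" "forest F" "\<forall>e\<in>edges G. t e \<in> ends G e"
    "\<forall>x. card (comp F x) \<le> Suc d" "\<forall>v. card {e \<in> edges G - F. t e = v} \<le> k"
    using ex_forest_orientation[OF mad_le_sparse[OF assms(3,4)] order_refl] by blast
  \<comment> \<open>Number the blue edges leaving a vertex differently below \<open>k\<close>. Each
    class then has at most one edge leaving any vertex, so \<open>t\<close> is injective on
    it.\<close>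
  have "\<exists>h. inj_on h {e \<in> edges G - F. t e = v} \<and> h ` {e \<in> edges G - F. t e = v} \<subseteq> {..<k}" for v
    by (subst inj_on_iff_card_le) (use F(5) finite_edges in auto)
  then obtain h where h: "\<And>v. inj_on (h v) {e \<in> edges G - F. t e = v}"
    "\<And>v. h v ` {e \<in> edges G - F. t e = v} \<subseteq> {..<k}" by metis
  \<comment> \<open>Index \<open>k\<close> holds the red forest, the member with small
    components.\<close>
  define cls where "cls i = (if i < k then {e \<in> edges G - F. h (t e) e = i} else F)" for i
  define H where "H i = \<lparr>verts = verts G, edges = cls i, ends = ends G\<rparr>" for i
  have cls: "cls i \<subseteq> edges G" for i using F(1) by (auto simp: cls_def)
  have multi: "finite_multigraph (H i)" for i
    using cls[of i] ends_subset card_ends finite_verts finite_subset[OF cls finite_edges]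
    by unfold_locales (auto simp: H_def)
  have in_cls: "h (t e) e < k" if "e \<in> edges G" "e \<notin> F" for e
    using h(2)[of "t e"] that by auto
  have "decomposition G {..<k + 1} H"
    unfolding decomposition_def
  proof (intro conjI ballI impI)
    show "subgraph (H i) G" for i
      using multi[of i] cls[of i] by (simp add: H_def subgraph_def finite_multigraph_def)
    show "edges (H i) \<inter> edges (H j) = {}" if "i \<in> {..<k + 1}" "j \<in> {..<k + 1}" "i \<noteq> j" for i j
      using that by (auto simp: H_def cls_def)
    have "e \<in> (\<Union>i\<in>{..<k + 1}. cls i)" if e: "e \<in> edges G" for e
    proof (cases "e \<in> F")
      case True
      then show ?thesis by (intro UN_I[of k]) (auto simp: cls_def)
    next
      case False
      then show ?thesis using in_cls[OF e False] e by (intro UN_I[of "h (t e) e"]) (auto simp: cls_def)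
    qed
    then show "(\<Union>i\<in>{..<k + 1}. edges (H i)) = edges G" using cls by (auto simp: H_def)
  qed
  moreover have "pseudoforest (H i)" for i
  proof (cases "i < k")
    case True
    have "inj_on t (edges (H i))"
    proof (rule inj_onI)
      fix e e' assume "e \<in> edges (H i)" "e' \<in> edges (H i)" "t e = t e'"
      then show "e = e'" using h(1)[of "t e"] True by (auto simp: H_def cls_def inj_on_def)
    qed
    then show ?thesis
      using F(3) cls[of i] by (intro pseudoforest_if_inj_tails[OF multi, of t]) (auto simp: H_def)
  next
    case False
    then show ?thesis using F(2) by (intro pseudoforest_if_forest[OF multi]) (simp add: H_def cls_def)
  qed
  moreover have "\<forall>C. connected_component C (H k) \<longrightarrow> card (edges C) \<le> d"
    using forest_component_edges[OF multi[of k], of d] F(2,4) by (simp add: H_def cls_def)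
  ultimately show ?thesis by (intro exI[of _ H]) auto
qed

end
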